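(* Let $a>0$ and let $l$ be a function of $R>0$ with $l(R)\to 0$ as $R\to\infty$. Let $\mathcal{I}_{a,l}$ be the set of all densities $f_{X_0+G_a}$ of random variables $X_0+G_a$, where $G_a\sim\mathcal{N}(0,a)$, $X_0$ is a real random variable independent of $G_a$ with $\mathbb{E}X_0=0$, and $$L_{X_0+G_a}(R)\le l(R)\qquad\text{for all } R>0.$$ Let $\overline{\mathcal{I}_{a,l}}$ be the closure of $\mathcal{I}_{a,l}$ in $L^1_{1+x^2}$. Then the set $\overline{\mathcal{I}_{a,l}}$ is compact in $L^1_{1+x^2}$, and hence also compact in $L^1=L^1(\mathbb{R},dx)$. Moreover, the Fisher-information functional $p\mapsto J(p)$ is continuous on $\overline{\mathcal{I}_{a,l}}$ with respect to the $L^1$ topology; equivalently, if $p_n,p\in\overline{\mathcal{I}_{a,l}}$ and $\|p_n-p\|_{L^1}\to 0$ as $n\to\infty$, then $J(p_n)\to J(p)$.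
   Context: $L^1_{1+x^2}=L^1(\mathbb{R},(1+x^2)\,dx)$ with its usual norm $\|f\|_{L^1_{1+x^2}}=\int_{\mathbb{R}}|f(x)|(1+x^2)\,dx$. For a real random variable $X$, define $$L_X(R)=\mathbb{E}\left[(X-\mathbb{E}X)^2\mathbf{1}_{\{|X-\mathbb{E}X|\ge R\}}\right].$$ For a probability density $p$ on $\mathbb{R}$ (having an absolutely continuous representative, which is used), the Fisher information (with respect to location) is $$J(p)=\int_{\{p>0\}}\frac{p'(x)^2}{p(x)}\,dx=4\,\|(\sqrt p)'\|_{L^2(\mathbb{R})}^2 .$$ *)

theory Defs
  imports "HOL-Probability.Probability"
begin

text \<open>
  Borel functions on the line modulo equality almost everywhere. The weighted spaces
  \<open>L\<^sup>1(\<real>, w(x) dx)\<close> with \<open>w > 0\<close> are all sets of such classes, so that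
  \<open>L\<^sup>1\<^bsub>1+x^2\<^esub>\<close> is literally a subset of \<open>L\<^sup>1\<close>.
\<close>

definition ae_eq :: "(real \<Rightarrow> real) \<Rightarrow> (real \<Rightarrow> real) \<Rightarrow> bool" where
  "ae_eq f g \<longleftrightarrow> f \<in> borel_measurable borel \<and> g \<in> borel_measurable borel \<and>
     (AE x in lborel. f x = g x)"

lemma part_equivp_ae_eq: "part_equivp ae_eq"
proof (rule part_equivpI)
  show "\<exists>f. ae_eq f f"
    by (intro exI[of _ "\<lambda>_. 0"]) (simp add: ae_eq_def)
  show "symp ae_eq"
    by (rule sympI) (simp add: ae_eq_def eq_commute)
  show "transp ae_eq"
  proof (rule transpI)
    fix f g h assume *: "ae_eq f g" "ae_eq g h"
    then have "AE x in lborel. f x = g x" "AE x in lborel. g x = h x"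
      by (simp_all add: ae_eq_def)
    then have "AE x in lborel. f x = h x"
      by eventually_elim simp
    with * show "ae_eq f h" by (simp add: ae_eq_def)
  qed
qed

quotient_type ae_fun = "real \<Rightarrow> real" / partial: ae_eq
  by (rule part_equivp_ae_eq)

lift_definition represents :: "(real \<Rightarrow> real) \<Rightarrow> ae_fun \<Rightarrow> bool" is ae_eq
  using part_equivp_symp[OF part_equivp_ae_eq] part_equivp_transp[OF part_equivp_ae_eq] by blast

lift_definition in_L1 :: "(real \<Rightarrow> real) \<Rightarrow> ae_fun \<Rightarrow> bool" is
  "\<lambda>w f. w \<in> borel_measurable borel \<and> integrable lborel (\<lambda>x. \<bar>f x\<bar> * w x)"
proof -
  fix w f g assume "ae_eq f g"
  then have [measurable]: "f \<in> borel_measurable borel" "g \<in> borel_measurable borel"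
    and ae: "AE x in lborel. f x = g x"
    by (auto simp: ae_eq_def)
  have "integrable lborel (\<lambda>x. \<bar>f x\<bar> * w x) \<longleftrightarrow> integrable lborel (\<lambda>x. \<bar>g x\<bar> * w x)"
    if [measurable]: "w \<in> borel_measurable borel"
  proof (rule integrable_cong_AE)
    show "AE x in lborel. \<bar>f x\<bar> * w x = \<bar>g x\<bar> * w x"
      using ae by eventually_elim simp
  qed measurable
  then show "(w \<in> borel_measurable borel \<and> integrable lborel (\<lambda>x. \<bar>f x\<bar> * w x)) =
      (w \<in> borel_measurable borel \<and> integrable lborel (\<lambda>x. \<bar>g x\<bar> * w x))"
    by blast
qed

lift_definition L1_dist :: "(real \<Rightarrow> real) \<Rightarrow> ae_fun \<Rightarrow> ae_fun \<Rightarrow> real" is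
  "\<lambda>w f g. if w \<in> borel_measurable borel then (LINT x|lborel. \<bar>f x - g x\<bar> * w x) else 0"
proof -
  fix w f f' g g' assume "ae_eq f f'" "ae_eq g g'"
  then have [measurable]: "f \<in> borel_measurable borel" "f' \<in> borel_measurable borel"
      "g \<in> borel_measurable borel" "g' \<in> borel_measurable borel"
    and ae: "AE x in lborel. f x = f' x" "AE x in lborel. g x = g' x"
    by (auto simp: ae_eq_def)
  have "(LINT x|lborel. \<bar>f x - g x\<bar> * w x) = (LINT x|lborel. \<bar>f' x - g' x\<bar> * w x)"
    if [measurable]: "w \<in> borel_measurable borel"
  proof (rule integral_cong_AE)
    show "AE x in lborel. \<bar>f x - g x\<bar> * w x = \<bar>f' x - g' x\<bar> * w x"
      using ae by eventually_elim simp
  qed measurable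
  then show "(if w \<in> borel_measurable borel then (LINT x|lborel. \<bar>f x - g x\<bar> * w x) else 0) =
      (if w \<in> borel_measurable borel then (LINT x|lborel. \<bar>f' x - g' x\<bar> * w x) else 0)"
    by simp
qed

abbreviation L1_space :: "(real \<Rightarrow> real) \<Rightarrow> ae_fun set" where
  "L1_space w \<equiv> Collect (in_L1 w)"

lemma ae_fun_exhaust:
  obtains f where "f \<in> borel_measurable borel" "p = abs_ae_fun f"
proof -
  have "\<exists>f. f \<in> borel_measurable borel \<and> p = abs_ae_fun f"
    by (induction p rule: ae_fun.abs_induct) (auto simp: ae_eq_def)
  then show ?thesis using that by blast
qed

lemma
  assumes "f \<in> borel_measurable borel"
  shows in_L1_abs: "in_L1 w (abs_ae_fun f) \<longleftrightarrow>
      w \<in> borel_measurable borel \<and> integrable lborel (\<lambda>x. \<bar>f x\<bar> * w x)"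
    and represents_abs: "represents g (abs_ae_fun f) \<longleftrightarrow> ae_eq g f"
  using assms by (simp_all add: in_L1.abs_eq represents.abs_eq ae_eq_def)

lemma
  assumes "f \<in> borel_measurable borel" "g \<in> borel_measurable borel"
  shows L1_dist_abs: "w \<in> borel_measurable borel \<Longrightarrow>
      L1_dist w (abs_ae_fun f) (abs_ae_fun g) = (LINT x|lborel. \<bar>f x - g x\<bar> * w x)"
    and abs_ae_fun_eq: "abs_ae_fun f = abs_ae_fun g \<longleftrightarrow> (AE x in lborel. f x = g x)"
proof -
  have "ae_eq f f" "ae_eq g g"
    using assms by (simp_all add: ae_eq_def)
  then show "w \<in> borel_measurable borel \<Longrightarrow>
      L1_dist w (abs_ae_fun f) (abs_ae_fun g) = (LINT x|lborel. \<bar>f x - g x\<bar> * w x)"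
    by (simp add: L1_dist.abs_eq)
  show "abs_ae_fun f = abs_ae_fun g \<longleftrightarrow> (AE x in lborel. f x = g x)"
    using Quotient_rel[OF Quotient_ae_fun, of f g] assms \<open>ae_eq f f\<close> \<open>ae_eq g g\<close>
    by (simp add: ae_eq_def)
qed

lemma Metric_space_L1:
  assumes w[measurable]: "w \<in> borel_measurable borel" and pos: "\<And>x. 0 < w x"
  shows "Metric_space (L1_space w) (L1_dist w)"
proof
  have pos': "0 \<le> w x" for x using pos[of x] by simp
  have mono: "\<bar>s + t\<bar> * w x \<le> \<bar>s\<bar> * w x + \<bar>t\<bar> * w x" for s t x
    using mult_right_mono[OF abs_triangle_ineq pos'] by (simp add: distrib_right)
  have int: "integrable lborel (\<lambda>x. \<bar>f x - g x\<bar> * w x)"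
    if "integrable lborel (\<lambda>x. \<bar>f x\<bar> * w x)" "integrable lborel (\<lambda>x. \<bar>g x\<bar> * w x)"
      and [measurable]: "f \<in> borel_measurable borel" "g \<in> borel_measurable borel" for f g
  proof (rule Bochner_Integration.integrable_bound[OF Bochner_Integration.integrable_add[OF that(1,2)]])
    show "AE x in lborel. norm (\<bar>f x - g x\<bar> * w x) \<le> norm (\<bar>f x\<bar> * w x + \<bar>g x\<bar> * w x)"
    proof (rule AE_I2)
      fix x
      show "norm (\<bar>f x - g x\<bar> * w x) \<le> norm (\<bar>f x\<bar> * w x + \<bar>g x\<bar> * w x)"
        using mono[of "f x" "- g x" x] pos'[of x] by (simp add: abs_mult)
    qed
  qed measurable
  fix p q r :: ae_fun
  obtain f where f[measurable]: "f \<in> borel_measurable borel" and p: "p = abs_ae_fun f"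
    by (rule ae_fun_exhaust)
  obtain g where g[measurable]: "g \<in> borel_measurable borel" and q: "q = abs_ae_fun g"
    by (rule ae_fun_exhaust)
  obtain h where h[measurable]: "h \<in> borel_measurable borel" and r: "r = abs_ae_fun h"
    by (rule ae_fun_exhaust)
  show "0 \<le> L1_dist w p q"
    unfolding p q L1_dist_abs[OF f g w] by (rule Bochner_Integration.integral_nonneg) (simp add: pos')
  show "L1_dist w p q = L1_dist w q p"
    unfolding p q L1_dist_abs[OF f g w] L1_dist_abs[OF g f w] by (simp add: abs_minus_commute)
  show "L1_dist w p q = 0 \<longleftrightarrow> p = q" if "p \<in> L1_space w" "q \<in> L1_space w"
  proof -
    have "(LINT x|lborel. \<bar>f x - g x\<bar> * w x) = 0 \<longleftrightarrow> (AE x in lborel. \<bar>f x - g x\<bar> * w x = 0)"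
      by (rule integral_nonneg_eq_0_iff_AE) (use that in \<open>auto simp: p q in_L1_abs f g int pos'\<close>)
    also have "\<dots> \<longleftrightarrow> (AE x in lborel. f x = g x)"
      by (simp add: less_imp_neq[OF pos, symmetric])
    finally show ?thesis
      unfolding p q L1_dist_abs[OF f g w] abs_ae_fun_eq[OF f g] .
  qed
  show "L1_dist w p r \<le> L1_dist w p q + L1_dist w q r"
    if "p \<in> L1_space w" "q \<in> L1_space w" "r \<in> L1_space w"
  proof -
    have i: "integrable lborel (\<lambda>x. \<bar>f x - h x\<bar> * w x)"
      "integrable lborel (\<lambda>x. \<bar>f x - g x\<bar> * w x)" "integrable lborel (\<lambda>x. \<bar>g x - h x\<bar> * w x)"
      using that by (simp_all add: p q r in_L1_abs f g h int)
    have "(LINT x|lborel. \<bar>f x - h x\<bar> * w x)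
        \<le> (LINT x|lborel. \<bar>f x - g x\<bar> * w x + \<bar>g x - h x\<bar> * w x)"
    proof (rule integral_mono[OF i(1) Bochner_Integration.integrable_add[OF i(2,3)]])
      show "\<bar>f x - h x\<bar> * w x \<le> \<bar>f x - g x\<bar> * w x + \<bar>g x - h x\<bar> * w x" for x
        using mono[of "f x - g x" "g x - h x" x] by simp
    qed
    then show ?thesis
      unfolding p q r L1_dist_abs[OF f g w] L1_dist_abs[OF g h w] L1_dist_abs[OF f h w]
        Bochner_Integration.integral_add[OF i(2,3)] .
  qed
qed

definition unit_weight :: "real \<Rightarrow> real" where
  "unit_weight x = 1"

definition quad_weight :: "real \<Rightarrow> real" where
  "quad_weight x = 1 + x\<^sup>2"

interpretation L1: Metric_space "L1_space unit_weight" "L1_dist unit_weight"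
  by (rule Metric_space_L1) (auto simp: unit_weight_def[abs_def])

interpretation L1_quad: Metric_space "L1_space quad_weight" "L1_dist quad_weight"
  by (rule Metric_space_L1)
    (auto simp: quad_weight_def[abs_def] intro: add_pos_nonneg)


text \<open>Extended-valued, so that it is \<open>\<infinity>\<close> rather than junk when \<open>X\<close> has infinite variance.\<close>

definition tail_variance :: "'w measure \<Rightarrow> ('w \<Rightarrow> real) \<Rightarrow> real \<Rightarrow> ennreal" where
  "tail_variance M X R =
     (\<integral>\<^sup>+\<omega>. ennreal ((X \<omega> - integral\<^sup>L M X)\<^sup>2) * indicator {\<omega>. R \<le> \<bar>X \<omega> - integral\<^sup>L M X\<bar>} \<omega> \<partial>M)"

text \<open>
  The variance of \<open>G\<close> is \<open>a\<close>, whereas \<^const>\<open>normal_density\<close> takes the standard deviation.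
  The comparison is made in the extended reals so that a negative value of \<open>l\<close> is not truncated.
\<close>

definition smoothed_pair ::
    "real \<Rightarrow> (real \<Rightarrow> real) \<Rightarrow> 'w measure \<Rightarrow> ('w \<Rightarrow> real) \<Rightarrow> ('w \<Rightarrow> real) \<Rightarrow> bool" where
  "smoothed_pair a l M X0 G \<longleftrightarrow>
     prob_space M \<and> X0 \<in> borel_measurable M \<and>
     prob_space.indep_var M borel X0 borel G \<and>
     distributed M lborel G (\<lambda>x. ennreal (normal_density 0 (sqrt a) x)) \<and>
     integrable M X0 \<and> integral\<^sup>L M X0 = 0 \<and>
     (\<forall>R>0. enn2ereal (tail_variance M (\<lambda>\<omega>. X0 \<omega> + G \<omega>) R) \<le> ereal (l R))"

text \<open>
  Membership depends only on the joint law of \<open>(X0, G)\<close>, so there is no loss in letting the sample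
  space range over the probability spaces on \<^typ>\<open>real \<times> real\<close>; see \<open>smoothed_densities_I\<close>.
\<close>

definition smoothed_densities :: "real \<Rightarrow> (real \<Rightarrow> real) \<Rightarrow> ae_fun set" where
  "smoothed_densities a l = {p. \<exists>(M :: (real \<times> real) measure) X0 G f.
     smoothed_pair a l M X0 G \<and> (\<forall>x. 0 \<le> f x) \<and>
     distributed M lborel (\<lambda>\<omega>. X0 \<omega> + G \<omega>) (\<lambda>x. ennreal (f x)) \<and> represents f p}"

lemma smoothed_densities_I:
  fixes M :: "'w measure"
  assumes pair: "smoothed_pair a l M X0 G" and nonneg: "\<And>x. 0 \<le> f x"
    and dens: "distributed M lborel (\<lambda>\<omega>. X0 \<omega> + G \<omega>) (\<lambda>x. ennreal (f x))"
    and rep: "represents f p"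
  shows "p \<in> smoothed_densities a l"
proof -
  interpret prob_space M using pair by (simp add: smoothed_pair_def)
  have [measurable]: "X0 \<in> borel_measurable M" "G \<in> borel_measurable M"
    using pair by (auto simp: smoothed_pair_def distributed_def)
  define N where "N = distr M (borel \<Otimes>\<^sub>M borel) (\<lambda>\<omega>. (X0 \<omega>, G \<omega>))"
  interpret N: prob_space N
    unfolding N_def by (rule prob_space_distr) simp
  have sets_N [measurable_cong]: "sets N = sets (borel \<Otimes>\<^sub>M borel)"
    by (simp add: N_def)
  have distr_N: "distr N K h = distr M K (\<lambda>\<omega>. h (X0 \<omega>, G \<omega>))"
    if "h \<in> measurable (borel \<Otimes>\<^sub>M borel) K" for h and K :: "'b measure"
    unfolding N_def using that by (subst distr_distr) (auto simp: o_def)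
  have int_N: "integral\<^sup>L N h = (LINT \<omega>|M. h (X0 \<omega>, G \<omega>))"
    if [measurable]: "h \<in> borel_measurable (borel \<Otimes>\<^sub>M borel)" for h :: "real \<times> real \<Rightarrow> real"
    unfolding N_def by (rule integral_distr) auto
  have "N.indep_var borel fst borel snd"
    using pair unfolding smoothed_pair_def N.indep_var_distribution_eq indep_var_distribution_eq
    by (simp add: distr_N)
  moreover have "distributed N lborel snd (\<lambda>x. ennreal (normal_density 0 (sqrt a) x))"
    using pair by (auto simp: smoothed_pair_def distributed_def distr_N)
  moreover have "integrable N fst" "integral\<^sup>L N fst = 0"
    using pair by (auto simp: smoothed_pair_def int_N) (simp add: N_def integrable_distr_eq)
  moreover have "tail_variance N (\<lambda>\<omega>. fst \<omega> + snd \<omega>) R = tail_variance M (\<lambda>\<omega>. X0 \<omega> + G \<omega>) R" for R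
    unfolding tail_variance_def
    by (simp add: int_N) (simp add: N_def nn_integral_distr indicator_def)
  moreover have "distributed N lborel (\<lambda>\<omega>. fst \<omega> + snd \<omega>) (\<lambda>x. ennreal (f x))"
    using dens by (auto simp: distributed_def distr_N)
  ultimately have "smoothed_pair a l N fst snd \<and>
      distributed N lborel (\<lambda>\<omega>. fst \<omega> + snd \<omega>) (\<lambda>x. ennreal (f x))"
    using pair N.prob_space_axioms by (simp add: smoothed_pair_def)
  then show ?thesis
    unfolding smoothed_densities_def using nonneg rep by blast
qed

definition smoothed_closure :: "real \<Rightarrow> (real \<Rightarrow> real) \<Rightarrow> ae_fun set" where
  "smoothed_closure a l = L1_quad.mtopology closure_of smoothed_densities a l"


definition absolutely_continuous_on :: "real set \<Rightarrow> (real \<Rightarrow> real) \<Rightarrow> bool" where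
  "absolutely_continuous_on S f \<longleftrightarrow> (\<forall>\<epsilon>>0. \<exists>\<delta>>0. \<forall>I. finite I \<longrightarrow>
     (\<forall>(u, v)\<in>I. u \<le> v \<and> {u..v} \<subseteq> S) \<longrightarrow>
     pairwise (\<lambda>(u, v) (u', v'). disjnt {u<..<v} {u'<..<v'}) I \<longrightarrow>
     (\<Sum>(u, v)\<in>I. v - u) < \<delta> \<longrightarrow> (\<Sum>(u, v)\<in>I. \<bar>f v - f u\<bar>) < \<epsilon>)"

text \<open>On the line, absolute continuity is meant locally, i.e. on every compact interval.\<close>

definition ac_density :: "(real \<Rightarrow> real) \<Rightarrow> bool" where
  "ac_density f \<longleftrightarrow> (\<forall>x. 0 \<le> f x) \<and> (\<integral>\<^sup>+x. ennreal (f x) \<partial>lborel) = 1 \<and>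
     (\<forall>c d. absolutely_continuous_on {c..d} f)"

text \<open>
  The representative is unique when it exists (a class contains at most one continuous function), and
  \<^const>\<open>deriv\<close> is the derivative at almost every point. Classes without such a
  representative get the value \<open>\<infinity>\<close>, so finiteness entails that the defining case applies.
\<close>

definition fisher_information :: "ae_fun \<Rightarrow> ennreal" where
  "fisher_information p =
     (if \<exists>f. represents f p \<and> ac_density f
      then let f = (SOME f. represents f p \<and> ac_density f) in
        (\<integral>\<^sup>+x. ennreal ((deriv f x)\<^sup>2 / f x) * indicator {x. 0 < f x} x \<partial>lborel)
      else \<infinity>)"

end

theory Submission
  imports Defs
begin

text \<open>
  The density of \<open>X\<^sub>0 + G\<^sub>a\<close> is \<open>p(x) = \<integral> \<gamma>(x - y) d\<mu>(y)\<close>, where \<open>\<mu>\<close> is the law of \<open>X\<^sub>0\<close> and \<open>\<gamma>\<close>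
  the Gaussian density. The tail condition bounds the second moments of the laws, so every sequence of
  laws has a weakly convergent subsequence. Along it \<open>p\<close> and \<open>p'\<close> converge pointwise, because
  \<open>\<gamma>\<close> and \<open>\<gamma>'\<close> are bounded and continuous; Scheffe's lemma gives convergence in \<open>L\<^sup>1\<close>, and the uniform
  tail bound, which survives in the limit by Fatou, gives convergence in the weighted space. For the
  Fisher information, Cauchy--Schwarz yields \<open>p'\<^sup>2/p \<le> \<integral> ((x - y)/a)\<^sup>2 \<gamma>(x - y) d\<mu>(y)\<close>. The right-hand
  side converges pointwise and always has integral \<open>1/a\<close>, hence converges in \<open>L\<^sup>1\<close>, so the Fisher
  integrands converge under a convergent sequence of dominating functions.
\<close>

section \<open>Mixtures of translates of a kernel\<close>

text \<open>If \<open>k\<close> is a probability density, this is the density of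
  \<open>Y + Z\<close> for independent \<open>Y\<close> of law \<open>\<mu>\<close> and
  \<open>Z\<close> of density \<open>k\<close>. Since \<open>k\<close> is arbitrary, the derivative
  and the Fisher majorant of such a density have the same form.\<close>

definition smear :: "(real \<Rightarrow> real) \<Rightarrow> real measure \<Rightarrow> real \<Rightarrow> real" where
  "smear k \<mu> x = (LINT y|\<mu>. k (x - y))"

lemma (in real_distribution) integrable_bounded_kernel:
  fixes k :: "real \<Rightarrow> real"
  assumes [measurable]: "k \<in> borel_measurable borel" and bound: "\<And>t. \<bar>k t\<bar> \<le> B"
  shows "integrable M (\<lambda>y. k (x - y))"
  by (rule integrable_const_bound[where B = B]) (use bound in auto)

lemma (in real_distribution) borel_measurable_smear [measurable]:
  assumes [measurable]: "k \<in> borel_measurable borel"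
  shows "smear k M \<in> borel_measurable borel"
  unfolding smear_def[abs_def] by measurable

text \<open>Tonelli, followed by the translation from \<open>x\<close> to \<open>x + y\<close> in
  the inner integral. Taking \<open>g\<close> to be 1, the square or an indicator gives the mass,
  the second moment and the distribution of the mixture.\<close>

lemma (in real_distribution) nn_integral_smear:
  fixes g :: "real \<Rightarrow> ennreal"
  assumes [measurable]: "k \<in> borel_measurable borel" "g \<in> borel_measurable borel"
    and bound: "\<And>t. \<bar>k t\<bar> \<le> B" and nonneg: "\<And>t. 0 \<le> k t"
  shows "(\<integral>\<^sup>+x. ennreal (smear k M x) * g x \<partial>lborel)
    = (\<integral>\<^sup>+y. (\<integral>\<^sup>+x. ennreal (k x) * g (x + y) \<partial>lborel) \<partial>M)"
proof -
  interpret pair_sigma_finite lborel M ..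
  have "ennreal (smear k M x) = (\<integral>\<^sup>+y. ennreal (k (x - y)) \<partial>M)" for x
    unfolding smear_def
    by (rule nn_integral_eq_integral[symmetric]) (use integrable_bounded_kernel[OF assms(1) bound] nonneg in auto)
  then have "(\<integral>\<^sup>+x. ennreal (smear k M x) * g x \<partial>lborel)
      = (\<integral>\<^sup>+x. (\<integral>\<^sup>+y. ennreal (k (x - y)) * g x \<partial>M) \<partial>lborel)"
    by (simp add: nn_integral_multc)
  also have "\<dots> = (\<integral>\<^sup>+y. (\<integral>\<^sup>+x. ennreal (k (x - y)) * g x \<partial>lborel) \<partial>M)"
    by (rule Fubini'[symmetric]) measurable
  also have "\<dots> = (\<integral>\<^sup>+y. (\<integral>\<^sup>+x. ennreal (k x) * g (x + y) \<partial>lborel) \<partial>M)"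
  proof (rule nn_integral_cong)
    fix y
    show "(\<integral>\<^sup>+x. ennreal (k (x - y)) * g x \<partial>lborel) = (\<integral>\<^sup>+x. ennreal (k x) * g (x + y) \<partial>lborel)"
      by (subst nn_integral_real_affine[where c = 1 and t = y]) (simp_all add: ac_simps)
  qed
  finally show ?thesis .
qed

lemma (in real_distribution) nn_integral_smear_total:
  assumes "k \<in> borel_measurable borel" "\<And>t. \<bar>k t\<bar> \<le> B" "\<And>t. 0 \<le> k t"
  shows "(\<integral>\<^sup>+x. ennreal (smear k M x) \<partial>lborel) = (\<integral>\<^sup>+x. ennreal (k x) \<partial>lborel)"
  using nn_integral_smear[OF assms(1) _ assms(2,3), of "\<lambda>_. 1"] emeasure_space_1 by simp

lemma (in real_distribution) smear_nonneg:
  assumes "\<And>t. 0 \<le> k t"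
  shows "0 \<le> smear k M x"
  unfolding smear_def using assms by simp

lemma smear_tendsto:
  assumes "\<And>n. real_distribution (\<mu> n)" "real_distribution \<nu>" "weak_conv_m \<mu> \<nu>"
    and "\<And>t. isCont k t" "\<And>t. \<bar>k t\<bar> \<le> B"
  shows "(\<lambda>n. smear k (\<mu> n) x) \<longlonglongrightarrow> smear k \<nu> x"
  unfolding smear_def
  by (rule weak_conv_imp_integral_bdd_continuous_conv[where B = B])
    (use assms in \<open>auto intro!: isCont_o2[where f = "\<lambda>y. x - y" and g = k] continuous_intros\<close>)

lemma abs_diff_le_of_deriv_bound:
  fixes k :: "real \<Rightarrow> real"
  assumes deriv: "\<And>t. (k has_field_derivative k' t) (at t)" and bound: "\<And>t. \<bar>k' t\<bar> \<le> B"
  shows "\<bar>k u - k v\<bar> \<le> B * \<bar>u - v\<bar>"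
  using field_differentiable_bound[of UNIV k k' B u v] assms by (simp add: dist_norm)

text \<open>Differentiation under the integral: by the mean value inequality all difference
  quotients are bounded by the constant \<open>B'\<close>, which is integrable for a probability
  measure. The limit is taken along sequences so that dominated convergence applies.\<close>

lemma (in real_distribution) DERIV_smear:
  assumes deriv: "\<And>t. (k has_field_derivative k' t) (at t)"
    and bound: "\<And>t. \<bar>k t\<bar> \<le> B" and bound': "\<And>t. \<bar>k' t\<bar> \<le> B'"
    and [measurable]: "k' \<in> borel_measurable borel"
  shows "(smear k M has_field_derivative smear k' M x) (at x)"
proof -
  have k[measurable]: "k \<in> borel_measurable borel"
    by (intro borel_measurable_continuous_onI continuous_at_imp_continuous_on ballI)
      (rule DERIV_isCont[OF deriv])
  note int = integrable_bounded_kernel[OF k bound]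
  show ?thesis
    unfolding DERIV_def tendsto_at_iff_sequentially
  proof (intro allI impI)
    fix X :: "nat \<Rightarrow> real" assume X: "\<forall>i. X i \<in> UNIV - {0}" "X \<longlonglongrightarrow> 0"
    have "(\<lambda>i. LINT y|M. (k (x + X i - y) - k (x - y)) / X i) \<longlonglongrightarrow> (LINT y|M. k' (x - y))"
    proof (rule integral_dominated_convergence[where w = "\<lambda>_. B'"])
      show "AE y in M. (\<lambda>i. (k (x + X i - y) - k (x - y)) / X i) \<longlonglongrightarrow> k' (x - y)"
      proof (rule AE_I2)
        fix y
        show "(\<lambda>i. (k (x + X i - y) - k (x - y)) / X i) \<longlonglongrightarrow> k' (x - y)"
          using deriv[of "x - y"] X unfolding DERIV_def tendsto_at_iff_sequentially
          by (auto simp: o_def algebra_simps)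
      qed
      show "AE y in M. norm ((k (x + X i - y) - k (x - y)) / X i) \<le> B'" for i
      proof (rule AE_I2)
        fix y
        show "norm ((k (x + X i - y) - k (x - y)) / X i) \<le> B'"
          using abs_diff_le_of_deriv_bound[OF deriv bound', of "x + X i - y" "x - y"] X(1)
          by (simp add: divide_simps)
      qed
    qed auto
    then show "((\<lambda>h. (smear k M (x + h) - smear k M x) / h) \<circ> X) \<longlonglongrightarrow> smear k' M x"
      by (simp add: o_def smear_def int)
  qed
qed

section \<open>The Gaussian kernel\<close>

abbreviation gauss :: "real \<Rightarrow> real \<Rightarrow> real" where
  "gauss a \<equiv> normal_density 0 (sqrt a)"

definition gauss_deriv :: "real \<Rightarrow> real \<Rightarrow> real" where
  "gauss_deriv a t = - (t / a) * gauss a t"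

text \<open>For positive \<open>a\<close> this is \<open>gauss_deriv\<close>, squared and divided by
  \<open>gauss\<close>: the Fisher integrand of the Gaussian itself.\<close>

definition gauss_fisher :: "real \<Rightarrow> real \<Rightarrow> real" where
  "gauss_fisher a t = (t / a)\<^sup>2 * gauss a t"

lemma borel_measurable_gauss_deriv [measurable]: "gauss_deriv a \<in> borel_measurable borel"
  and borel_measurable_gauss_fisher [measurable]: "gauss_fisher a \<in> borel_measurable borel"
  unfolding gauss_deriv_def[abs_def] gauss_fisher_def[abs_def] by measurable

context
  fixes a :: real
  assumes a_pos: "0 < a"
begin

lemma DERIV_gauss: "(gauss a has_field_derivative gauss_deriv a t) (at t)"
  unfolding gauss_deriv_def normal_density_def[abs_def]
  by (auto intro!: derivative_eq_intros simp: a_pos a_pos[THEN less_imp_neq, symmetric] less_imp_le field_simps)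

lemma isCont_gauss: "isCont (gauss a) t"
  using DERIV_gauss by (rule DERIV_isCont)

lemma isCont_gauss_deriv: "isCont (gauss_deriv a) t"
  unfolding gauss_deriv_def[abs_def] by (intro continuous_intros isCont_gauss) (use a_pos in auto)

lemma isCont_gauss_fisher: "isCont (gauss_fisher a) t"
  unfolding gauss_fisher_def[abs_def] by (intro continuous_intros isCont_gauss) (use a_pos in auto)

lemma gauss_pos: "0 < gauss a t"
  by (rule normal_density_pos) (use a_pos in simp)

lemma gauss_fisher_nonneg: "0 \<le> gauss_fisher a t"
  unfolding gauss_fisher_def using gauss_pos[of t] by simp

lemma gauss_bound: "\<bar>gauss a t\<bar> \<le> 1 / sqrt (2 * pi * a)"
  using a_pos by (simp add: normal_density_def divide_right_mono)

text \<open>With \<open>s = t^2 / (2 * a)\<close>, the factor in front of the normalising constant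
  is \<open>(2 / a) * s * exp (- s)\<close>, and \<open>s\<close> is at most
  \<open>exp s\<close>.\<close>

lemma gauss_fisher_bound: "\<bar>gauss_fisher a t\<bar> \<le> (2 / a) * (1 / sqrt (2 * pi * a))"
proof -
  have "t\<^sup>2 / (2 * a) \<le> exp (t\<^sup>2 / (2 * a))"
    using exp_ge_add_one_self[of "t\<^sup>2 / (2 * a)"] by linarith
  then have "(t / a)\<^sup>2 * exp (- t\<^sup>2 / (2 * a)) \<le> 2 / a"
    using a_pos by (simp add: exp_minus field_simps power2_eq_square)
  then have "(t / a)\<^sup>2 * exp (- t\<^sup>2 / (2 * a)) * (1 / sqrt (2 * pi * a)) \<le> (2 / a) * (1 / sqrt (2 * pi * a))"
    by (rule mult_right_mono) (use a_pos in simp)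
  moreover have "gauss_fisher a t = (t / a)\<^sup>2 * exp (- t\<^sup>2 / (2 * a)) * (1 / sqrt (2 * pi * a))"
    using a_pos by (simp add: gauss_fisher_def normal_density_def)
  ultimately show ?thesis
    using gauss_fisher_nonneg[of t] by simp
qed

text \<open>Since \<open>\<bar>t / a\<bar>\<close> is at most \<open>1 + (t / a)^2\<close>, the
  derivative is dominated by \<open>gauss + gauss_fisher\<close>, and the two previous bounds add
  up.\<close>

lemma gauss_deriv_bound: "\<bar>gauss_deriv a t\<bar> \<le> (1 + 2 / a) * (1 / sqrt (2 * pi * a))"
proof -
  have "\<bar>t / a\<bar> \<le> 1 + (t / a)\<^sup>2"
  proof (cases "\<bar>t / a\<bar> \<le> 1")
    case False
    then have "\<bar>t / a\<bar> * 1 \<le> \<bar>t / a\<bar> * \<bar>t / a\<bar>" by (intro mult_left_mono) auto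
    then show ?thesis by (simp add: power2_eq_square)
  qed (use zero_le_power2[of "t / a"] in linarith)
  then have "\<bar>t / a\<bar> * gauss a t \<le> (1 + (t / a)\<^sup>2) * gauss a t"
    by (rule mult_right_mono) (rule less_imp_le[OF gauss_pos])
  then have "\<bar>gauss_deriv a t\<bar> \<le> gauss a t + gauss_fisher a t"
    using gauss_pos[of t] by (simp add: gauss_deriv_def gauss_fisher_def abs_mult algebra_simps)
  also have "\<dots> \<le> 1 / sqrt (2 * pi * a) + (2 / a) * (1 / sqrt (2 * pi * a))"
    using gauss_bound[of t] gauss_fisher_bound[of t] by linarith
  also have "\<dots> = (1 + 2 / a) * (1 / sqrt (2 * pi * a))"
    by (simp only: distrib_right mult_1)
  finally show ?thesis .
qed

lemma nn_integral_gauss: "(\<integral>\<^sup>+x. ennreal (gauss a x) \<partial>lborel) = 1"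
  by (subst nn_integral_eq_integral) (use a_pos in \<open>auto simp: normal_density_nonneg\<close>)

lemma nn_integral_gauss_fisher: "(\<integral>\<^sup>+x. ennreal (gauss_fisher a x) \<partial>lborel) = ennreal (1 / a)"
proof -
  have "has_bochner_integral lborel (\<lambda>x. (gauss a x * (x - 0) ^ (2 * 1)) / a\<^sup>2) (a / a\<^sup>2)"
    using normal_moment_even[of "sqrt a" 0 1] a_pos
    by (intro has_bochner_integral_divide) (auto simp: fact_numeral)
  moreover have "(\<lambda>x. (gauss a x * (x - 0) ^ (2 * 1)) / a\<^sup>2) = gauss_fisher a"
    by (simp add: gauss_fisher_def fun_eq_iff power_divide)
  ultimately have "has_bochner_integral lborel (gauss_fisher a) (1 / a)"
    using a_pos by (simp add: power2_eq_square)
  then have "integrable lborel (gauss_fisher a)" "(LINT x|lborel. gauss_fisher a x) = 1 / a"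
    by (auto simp: has_bochner_integral_iff)
  then show ?thesis
    by (subst nn_integral_eq_integral) (auto simp: gauss_fisher_nonneg)
qed

text \<open>The integral equals \<open>a + y^2\<close>. The inequality expresses that adding a
  centred Gaussian does not decrease second moments.\<close>

lemma gauss_second_moment:
  "ennreal (y\<^sup>2) \<le> (\<integral>\<^sup>+x. ennreal (gauss a x) * ennreal ((x + y)\<^sup>2) \<partial>lborel)"
proof -
  have i: "has_bochner_integral lborel (\<lambda>x. gauss a x * x ^ 2) a"
    using normal_moment_even[of "sqrt a" 0 1] a_pos by (auto simp: fact_numeral)
  have ii: "has_bochner_integral lborel (\<lambda>x. gauss a x * x) 0"
    using normal_moment_nz_1[of "sqrt a" 0] a_pos by auto
  have iii: "has_bochner_integral lborel (\<lambda>x. gauss a x) 1"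
    using a_pos by (simp add: has_bochner_integral_iff)
  have "has_bochner_integral lborel
      (\<lambda>x. gauss a x * x ^ 2 + (2 * y) * (gauss a x * x) + y\<^sup>2 * gauss a x) (a + (2 * y) * 0 + y\<^sup>2 * 1)"
    by (intro has_bochner_integral_add has_bochner_integral_mult_right i ii iii)
  moreover have "(\<lambda>x. gauss a x * x ^ 2 + (2 * y) * (gauss a x * x) + y\<^sup>2 * gauss a x)
      = (\<lambda>x. gauss a x * (x + y)\<^sup>2)"
    by (simp add: fun_eq_iff power2_eq_square algebra_simps)
  ultimately have "has_bochner_integral lborel (\<lambda>x. gauss a x * (x + y)\<^sup>2) (a + y\<^sup>2)"
    by simp
  then have "(\<integral>\<^sup>+x. ennreal (gauss a x * (x + y)\<^sup>2) \<partial>lborel) = ennreal (a + y\<^sup>2)"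
    by (subst nn_integral_eq_integral) (auto simp: has_bochner_integral_iff normal_density_nonneg)
  then show ?thesis
    using a_pos by (simp add: ennreal_mult normal_density_nonneg)
qed

end

section \<open>Absolute continuity\<close>

lemma absolutely_continuous_on_lipschitz:
  assumes lip: "\<And>u v. \<bar>f u - f v\<bar> \<le> B * \<bar>u - v\<bar>"
  shows "absolutely_continuous_on S f"
  unfolding absolutely_continuous_on_def
proof (intro allI impI)
  fix \<epsilon> :: real assume "0 < \<epsilon>"
  have B: "0 \<le> B" using lip[of 1 0] by (smt (verit) zero_le_mult_iff)
  \<comment> \<open>Dividing by \<open>B + 1\<close> rather than \<open>B\<close> covers the case
    \<open>B = 0\<close>.\<close>
  have "(\<Sum>(u, v)\<in>I. \<bar>f v - f u\<bar>) < \<epsilon>"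
    if I: "\<forall>(u, v)\<in>I. u \<le> v \<and> {u..v} \<subseteq> S" "(\<Sum>(u, v)\<in>I. v - u) < \<epsilon> / (B + 1)" for I
  proof -
    have "(\<Sum>(u, v)\<in>I. \<bar>f v - f u\<bar>) \<le> (\<Sum>(u, v)\<in>I. (B + 1) * (v - u))"
    proof (rule sum_mono, clarify)
      fix u v assume "(u, v) \<in> I"
      then have "u \<le> v" using I by auto
      moreover have "B * (v - u) \<le> (B + 1) * (v - u)"
        by (rule mult_right_mono) (use \<open>u \<le> v\<close> in auto)
      ultimately show "\<bar>f v - f u\<bar> \<le> (B + 1) * (v - u)" using lip[of v u] by simp
    qed
    also have "\<dots> = (B + 1) * (\<Sum>(u, v)\<in>I. v - u)"
      by (simp add: sum_distrib_left case_prod_unfold)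
    also have "\<dots> < \<epsilon>"
      using I(2) B by (simp add: field_simps)
    finally show ?thesis .
  qed
  then show "\<exists>\<delta>>0. \<forall>I. finite I \<longrightarrow> (\<forall>(u, v)\<in>I. u \<le> v \<and> {u..v} \<subseteq> S) \<longrightarrow>
     pairwise (\<lambda>(u, v) (u', v'). disjnt {u<..<v} {u'<..<v'}) I \<longrightarrow>
     (\<Sum>(u, v)\<in>I. v - u) < \<delta> \<longrightarrow> (\<Sum>(u, v)\<in>I. \<bar>f v - f u\<bar>) < \<epsilon>"
    using \<open>0 < \<epsilon>\<close> B by (intro exI[of _ "\<epsilon> / (B + 1)"]) auto
qed

text \<open>A single interval is an admissible family; \<open>min\<close> and \<open>max\<close>
  orient it whichever of the two points is larger.\<close>

lemma absolutely_continuous_imp_continuous_on: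
  assumes "absolutely_continuous_on {c..d} f"
  shows "continuous_on {c..d} f"
  unfolding continuous_on_iff
proof (intro ballI allI impI)
  fix x \<epsilon> :: real assume x: "x \<in> {c..d}" and "0 < \<epsilon>"
  then obtain \<delta> where "\<delta> > 0" and \<delta>: "\<And>I. finite I \<Longrightarrow>
     (\<forall>(u, v)\<in>I. u \<le> v \<and> {u..v} \<subseteq> {c..d}) \<Longrightarrow>
     pairwise (\<lambda>(u, v) (u', v'). disjnt {u<..<v} {u'<..<v'}) I \<Longrightarrow>
     (\<Sum>(u, v)\<in>I. v - u) < \<delta> \<Longrightarrow> (\<Sum>(u, v)\<in>I. \<bar>f v - f u\<bar>) < \<epsilon>"
    using assms unfolding absolutely_continuous_on_def by meson
  have "dist (f y) (f x) < \<epsilon>" if y: "y \<in> {c..d}" "dist y x < \<delta>" for y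
    using \<delta>[of "{(min x y, max x y)}"] x y
    by (cases "x \<le> y") (auto simp: dist_real_def min_def max_def abs_minus_commute)
  then show "\<exists>\<delta>>0. \<forall>y\<in>{c..d}. dist y x < \<delta> \<longrightarrow> dist (f y) (f x) < \<epsilon>"
    using \<open>\<delta> > 0\<close> by blast
qed

lemma ac_density_imp_isCont:
  assumes "ac_density f"
  shows "isCont f x"
proof -
  have "continuous_on {x - 1..x + 1} f"
    using assms by (intro absolutely_continuous_imp_continuous_on) (simp add: ac_density_def)
  then show ?thesis
    by (rule continuous_on_interior) simp
qed

text \<open>The set where the functions differ is open and null, hence empty. This makes the
  representative chosen in \<open>fisher_information\<close> unique.\<close>

lemma continuous_AE_lborel_eq:
  fixes f g :: "real \<Rightarrow> real"
  assumes "\<And>x. isCont f x" "\<And>x. isCont g x" and AE: "AE x in lborel. f x = g x"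
  shows "f = g"
proof (rule ccontr)
  assume "f \<noteq> g"
  have op: "open {x. f x \<noteq> g x}"
    using assms by (intro open_Collect_neq continuous_at_imp_continuous_on) auto
  moreover have "{x. f x \<noteq> g x} \<noteq> {}" using \<open>f \<noteq> g\<close> by auto
  ultimately have "\<not> negligible {x. f x \<noteq> g x}"
    by (rule open_not_negligible)
  moreover have "{x. f x \<noteq> g x} \<in> null_sets lborel"
    using AE op by (subst AE_iff_null_sets) auto
  then have "negligible {x. f x \<noteq> g x}"
    by (simp add: negligible_iff_null_sets null_sets_completionI)
  ultimately show False by contradiction
qed

section \<open>Weak convergence and Fisher information\<close>

text \<open>The truncations \<open>min (F n x) (h x)\<close> are dominated by the fixed
  \<open>h\<close> and converge to \<open>f\<close>. What is cut off is at most
  \<open>\<bar>H n x - h x\<bar>\<close>, whose integral vanishes in the limit.\<close>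

lemma nn_integral_tendsto_of_variable_bound:
  fixes F H :: "nat \<Rightarrow> 'a \<Rightarrow> real" and f h :: "'a \<Rightarrow> real"
  assumes [measurable]: "\<And>n. F n \<in> borel_measurable M" "\<And>n. H n \<in> borel_measurable M"
      "f \<in> borel_measurable M" "h \<in> borel_measurable M"
    and F: "\<And>n x. 0 \<le> F n x" "\<And>n x. F n x \<le> H n x" "\<And>x. (\<lambda>n. F n x) \<longlonglongrightarrow> f x"
    and f: "\<And>x. 0 \<le> f x" "\<And>x. f x \<le> h x"
    and fin: "(\<integral>\<^sup>+x. ennreal (h x) \<partial>M) < \<infinity>"
    and H: "(\<lambda>n. \<integral>\<^sup>+x. ennreal \<bar>H n x - h x\<bar> \<partial>M) \<longlonglongrightarrow> 0"
  shows "(\<lambda>n. \<integral>\<^sup>+x. ennreal (F n x) \<partial>M) \<longlonglongrightarrow> (\<integral>\<^sup>+x. ennreal (f x) \<partial>M)"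
proof -
  have lim: "(\<lambda>n. \<integral>\<^sup>+x. ennreal (min (F n x) (h x)) \<partial>M) \<longlonglongrightarrow> (\<integral>\<^sup>+x. ennreal (f x) \<partial>M)"
  proof (rule nn_integral_dominated_convergence[where w = "\<lambda>x. ennreal (h x)"])
    have "(\<lambda>n. ennreal (min (F n x) (h x))) \<longlonglongrightarrow> ennreal (min (f x) (h x))" for x
      by (intro tendsto_ennrealI tendsto_min F tendsto_const)
    then show "AE x in M. (\<lambda>n. ennreal (min (F n x) (h x))) \<longlonglongrightarrow> ennreal (f x)"
      using f(2) by (simp add: min_absorb1)
    show "AE x in M. ennreal (min (F n x) (h x)) \<le> ennreal (h x)" for n
      by (intro AE_I2 ennreal_leI) simp
  qed (use fin in simp_all)
  show ?thesis
  proof (rule tendsto_sandwich)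
    show "\<forall>\<^sub>F n in sequentially. (\<integral>\<^sup>+x. ennreal (min (F n x) (h x)) \<partial>M) \<le> (\<integral>\<^sup>+x. ennreal (F n x) \<partial>M)"
      by (intro always_eventually allI nn_integral_mono ennreal_leI) simp
    show "\<forall>\<^sub>F n in sequentially. (\<integral>\<^sup>+x. ennreal (F n x) \<partial>M)
        \<le> (\<integral>\<^sup>+x. ennreal (min (F n x) (h x)) \<partial>M) + (\<integral>\<^sup>+x. ennreal \<bar>H n x - h x\<bar> \<partial>M)"
    proof (intro always_eventually allI)
      fix n
      have "ennreal (F n x) \<le> ennreal (min (F n x) (h x)) + ennreal \<bar>H n x - h x\<bar>" for x
      proof -
        have "0 \<le> h x" using f[of x] by simp
        then have "ennreal (min (F n x) (h x)) + ennreal \<bar>H n x - h x\<bar>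
            = ennreal (min (F n x) (h x) + \<bar>H n x - h x\<bar>)"
          using F(1)[of n x] by (intro ennreal_plus[symmetric]) auto
        moreover have "F n x \<le> min (F n x) (h x) + \<bar>H n x - h x\<bar>"
          using F(2)[of n x] by (simp add: min_def)
        ultimately show ?thesis by (simp add: ennreal_leI)
      qed
      then have "(\<integral>\<^sup>+x. ennreal (F n x) \<partial>M)
          \<le> (\<integral>\<^sup>+x. (ennreal (min (F n x) (h x)) + ennreal \<bar>H n x - h x\<bar>) \<partial>M)"
        by (intro nn_integral_mono)
      then show "(\<integral>\<^sup>+x. ennreal (F n x) \<partial>M)
          \<le> (\<integral>\<^sup>+x. ennreal (min (F n x) (h x)) \<partial>M) + (\<integral>\<^sup>+x. ennreal \<bar>H n x - h x\<bar> \<partial>M)"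
        by (subst (asm) nn_integral_add) auto
    qed
    show "(\<lambda>n. (\<integral>\<^sup>+x. ennreal (min (F n x) (h x)) \<partial>M) + (\<integral>\<^sup>+x. ennreal \<bar>H n x - h x\<bar> \<partial>M))
        \<longlonglongrightarrow> (\<integral>\<^sup>+x. ennreal (f x) \<partial>M)"
      using tendsto_add[OF lim H] by simp
  qed (rule lim)
qed

text \<open>The mass of \<open>smear k \<mu>\<close> does not depend on \<open>\<mu>\<close>, so Scheffe's lemma applies.\<close>

lemma smear_tendsto_L1:
  assumes \<mu>: "\<And>n. real_distribution (\<mu> n)" and \<nu>: "real_distribution \<nu>" and conv: "weak_conv_m \<mu> \<nu>"
    and cont: "\<And>t. isCont k t" and bound: "\<And>t. \<bar>k t\<bar> \<le> B" and nonneg: "\<And>t. 0 \<le> k t"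
    and fin: "(\<integral>\<^sup>+x. ennreal (k x) \<partial>lborel) < \<infinity>"
  shows "(\<lambda>n. \<integral>\<^sup>+x. ennreal \<bar>smear k (\<mu> n) x - smear k \<nu> x\<bar> \<partial>lborel) \<longlonglongrightarrow> 0"
proof -
  have k[measurable]: "k \<in> borel_measurable borel"
    by (intro borel_measurable_continuous_onI continuous_at_imp_continuous_on ballI cont)
  note [measurable] = real_distribution.borel_measurable_smear[OF \<mu> k]
    real_distribution.borel_measurable_smear[OF \<nu> k]
  have total: "(\<integral>\<^sup>+x. ennreal (norm (smear k M x)) \<partial>lborel) = (\<integral>\<^sup>+x. ennreal (k x) \<partial>lborel)"
    if "real_distribution M" for M
    using real_distribution.nn_integral_smear_total[OF that k bound nonneg]
      real_distribution.smear_nonneg[OF that nonneg] by simp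
  have "(\<lambda>n. \<integral>\<^sup>+x. ennreal (norm (smear k (\<mu> n) x - smear k \<nu> x)) \<partial>lborel) \<longlonglongrightarrow> 0"
  proof (rule Scheffe_lemma2)
    show "integrable lborel (smear k \<nu>)"
      by (rule integrableI_bounded) (use fin total[OF \<nu>] in simp_all)
    show "AE x in lborel. (\<lambda>n. smear k (\<mu> n) x) \<longlonglongrightarrow> smear k \<nu> x"
      using smear_tendsto[OF \<mu> \<nu> conv cont bound] by simp
  qed (use total \<mu> \<nu> in simp_all)
  then show ?thesis by simp
qed

section \<open>Fisher information of Gaussian mixtures\<close>

context
  fixes a :: real
  assumes a_pos: "0 < a"
begin

lemma smear_gauss_pos:
  assumes "real_distribution M"
  shows "0 < smear (gauss a) M x"
proof -
  interpret real_distribution M by fact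
  show ?thesis
    unfolding smear_def
    by (rule expectation_greater[OF integrable_bounded_kernel[OF _ gauss_bound[OF a_pos]]])
      (auto simp: gauss_pos a_pos)
qed

lemma DERIV_smear_gauss:
  assumes "real_distribution M"
  shows "(smear (gauss a) M has_field_derivative smear (gauss_deriv a) M x) (at x)"
  by (rule real_distribution.DERIV_smear[OF assms DERIV_gauss gauss_bound gauss_deriv_bound])
    (use a_pos in auto)

text \<open>The derivative of the mixture inherits the bound on \<open>gauss_deriv\<close>, so the
  mixture is globally Lipschitz; its mass is that of the kernel.\<close>

lemma ac_density_smear_gauss:
  assumes "real_distribution M"
  shows "ac_density (smear (gauss a) M)"
proof -
  interpret real_distribution M by fact
  let ?B = "(1 + 2 / a) * (1 / sqrt (2 * pi * a))"
  have "\<bar>smear (gauss_deriv a) M x\<bar> \<le> ?B" for x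
  proof -
    have "\<bar>smear (gauss_deriv a) M x\<bar> \<le> (LINT y|M. \<bar>gauss_deriv a (x - y)\<bar>)"
      unfolding smear_def by (rule integral_abs_bound)
    also have "\<dots> \<le> (LINT y|M. ?B)"
      by (intro integral_mono integrable_abs integrable_bounded_kernel[OF _ gauss_deriv_bound[OF a_pos]]
          gauss_deriv_bound a_pos) auto
    finally show ?thesis using prob_space by simp
  qed
  then have lip: "\<bar>smear (gauss a) M u - smear (gauss a) M v\<bar> \<le> ?B * \<bar>u - v\<bar>" for u v
    using abs_diff_le_of_deriv_bound[OF DERIV_smear_gauss[OF assms]] by blast
  show ?thesis
    unfolding ac_density_def
    using absolutely_continuous_on_lipschitz[OF lip] smear_gauss_pos[OF assms]
      nn_integral_smear_total[OF _ gauss_bound[OF a_pos]] nn_integral_gauss[OF a_pos]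
    by (auto simp: less_imp_le normal_density_nonneg)
qed

lemma fisher_information_smear_gauss:
  assumes M: "real_distribution M"
  shows "fisher_information (abs_ae_fun (smear (gauss a) M))
    = (\<integral>\<^sup>+x. ennreal ((smear (gauss_deriv a) M x)\<^sup>2 / smear (gauss a) M x) \<partial>lborel)"
proof -
  let ?p = "smear (gauss a) M"
  have [measurable]: "?p \<in> borel_measurable borel"
    using M by (rule real_distribution.borel_measurable_smear) simp
  \<comment> \<open>Absolutely continuous representatives are continuous, so only the mixture itself
    qualifies and \<open>SOME\<close> must select it.\<close>
  have rep: "represents f (abs_ae_fun ?p) \<and> ac_density f \<longleftrightarrow> f = ?p" for f
  proof
    assume "represents f (abs_ae_fun ?p) \<and> ac_density f"
    then show "f = ?p"
      by (intro continuous_AE_lborel_eq ac_density_imp_isCont ac_density_smear_gauss M)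
        (auto simp: represents_abs ae_eq_def)
  next
    assume "f = ?p"
    then show "represents f (abs_ae_fun ?p) \<and> ac_density f"
      using ac_density_smear_gauss[OF M] by (simp add: represents_abs ae_eq_def)
  qed
  have "deriv ?p x = smear (gauss_deriv a) M x" for x
    by (rule DERIV_imp_deriv[OF DERIV_smear_gauss[OF M]])
  then show ?thesis
    unfolding fisher_information_def rep by (simp add: smear_gauss_pos[OF M])
qed

text \<open>
  With \<open>c = p'/p\<close>, this is \<open>0 \<le> \<integral> (c + (x - y)/a)\<^sup>2 \<gamma>(x - y) d\<mu>(y)\<close> expanded, where \<open>\<gamma>\<close> is the
  Gaussian density.
\<close>

lemma fisher_integrand_le:
  assumes M: "real_distribution M"
  shows "(smear (gauss_deriv a) M x)\<^sup>2 / smear (gauss a) M x \<le> smear (gauss_fisher a) M x"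
proof -
  interpret real_distribution M by fact
  have int: "integrable M (\<lambda>y. gauss a (x - y))" "integrable M (\<lambda>y. gauss_deriv a (x - y))"
      "integrable M (\<lambda>y. gauss_fisher a (x - y))"
    by (rule integrable_bounded_kernel[OF _ gauss_bound[OF a_pos]]
      integrable_bounded_kernel[OF _ gauss_deriv_bound[OF a_pos]]
      integrable_bounded_kernel[OF _ gauss_fisher_bound[OF a_pos]], measurable)+
  define p q h where "p = smear (gauss a) M x" "q = smear (gauss_deriv a) M x" "h = smear (gauss_fisher a) M x"
  note pqh = this
  have "0 < p" unfolding pqh by (rule smear_gauss_pos[OF M])
  define c where "c = q / p"
  have "0 \<le> (LINT y|M. gauss_fisher a (x - y) - 2 * c * gauss_deriv a (x - y) + c\<^sup>2 * gauss a (x - y))"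
  proof (rule Bochner_Integration.integral_nonneg)
    fix y
    have "gauss_fisher a (x - y) - 2 * c * gauss_deriv a (x - y) + c\<^sup>2 * gauss a (x - y)
        = ((x - y) / a + c)\<^sup>2 * gauss a (x - y)"
      by (simp add: gauss_fisher_def gauss_deriv_def power2_eq_square algebra_simps)
    also have "0 \<le> \<dots>" by (simp add: normal_density_nonneg)
    finally show "0 \<le> gauss_fisher a (x - y) - 2 * c * gauss_deriv a (x - y) + c\<^sup>2 * gauss a (x - y)" .
  qed
  also have "\<dots> = h - 2 * c * q + c\<^sup>2 * p"
    unfolding pqh smear_def using int by simp
  also have "\<dots> = h - q\<^sup>2 / p"
    using \<open>0 < p\<close> by (simp add: c_def field_simps power2_eq_square)
  finally show ?thesis by (simp add: pqh)
qed

text \<open>Integrating \<open>fisher_integrand_le\<close> bounds the Fisher information of the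
  mixture by that of the Gaussian, namely \<open>1 / a\<close>.\<close>

lemma fisher_information_smear_gauss_finite:
  assumes M: "real_distribution M"
  shows "fisher_information (abs_ae_fun (smear (gauss a) M)) < \<infinity>"
proof -
  have "fisher_information (abs_ae_fun (smear (gauss a) M))
      \<le> (\<integral>\<^sup>+x. ennreal (smear (gauss_fisher a) M x) \<partial>lborel)"
    unfolding fisher_information_smear_gauss[OF M]
    by (intro nn_integral_mono ennreal_leI fisher_integrand_le M)
  also have "\<dots> = ennreal (1 / a)"
    using real_distribution.nn_integral_smear_total[OF M _ gauss_fisher_bound gauss_fisher_nonneg] a_pos
    by (simp add: nn_integral_gauss_fisher)
  finally show ?thesis
    by (rule le_less_trans) simp
qed

text \<open>The integrands converge pointwise because the limiting density is positive everywhere.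
  Their majorants converge in L1 by Scheffe's lemma, all having integral
  \<open>1 / a\<close>.\<close>

lemma fisher_information_weak_conv:
  assumes \<mu>: "\<And>n. real_distribution (\<mu> n)" and \<nu>: "real_distribution \<nu>" and conv: "weak_conv_m \<mu> \<nu>"
  shows "(\<lambda>n. fisher_information (abs_ae_fun (smear (gauss a) (\<mu> n))))
    \<longlonglongrightarrow> fisher_information (abs_ae_fun (smear (gauss a) \<nu>))"
  unfolding fisher_information_smear_gauss[OF \<mu>] fisher_information_smear_gauss[OF \<nu>]
proof (rule nn_integral_tendsto_of_variable_bound[where H = "\<lambda>n. smear (gauss_fisher a) (\<mu> n)"
      and h = "smear (gauss_fisher a) \<nu>"])
  note [measurable] = real_distribution.borel_measurable_smear[OF \<mu>]
    real_distribution.borel_measurable_smear[OF \<nu>]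
  show "(\<lambda>x. (smear (gauss_deriv a) (\<mu> n) x)\<^sup>2 / smear (gauss a) (\<mu> n) x) \<in> borel_measurable lborel" for n
    by measurable
  show "(\<lambda>x. (smear (gauss_deriv a) \<nu> x)\<^sup>2 / smear (gauss a) \<nu> x) \<in> borel_measurable lborel"
    by measurable
  show "smear (gauss_fisher a) (\<mu> n) \<in> borel_measurable lborel" for n
    by measurable
  show "smear (gauss_fisher a) \<nu> \<in> borel_measurable lborel"
    by measurable
  show "0 \<le> (smear (gauss_deriv a) (\<mu> n) x)\<^sup>2 / smear (gauss a) (\<mu> n) x" for n x
    using smear_gauss_pos[OF \<mu>, of n x] by simp
  show "0 \<le> (smear (gauss_deriv a) \<nu> x)\<^sup>2 / smear (gauss a) \<nu> x" for x
    using smear_gauss_pos[OF \<nu>, of x] by simp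
  show "(\<lambda>n. (smear (gauss_deriv a) (\<mu> n) x)\<^sup>2 / smear (gauss a) (\<mu> n) x)
      \<longlonglongrightarrow> (smear (gauss_deriv a) \<nu> x)\<^sup>2 / smear (gauss a) \<nu> x" for x
    using smear_gauss_pos[OF \<nu>, of x]
    by (intro tendsto_intros smear_tendsto[OF \<mu> \<nu> conv isCont_gauss gauss_bound]
        smear_tendsto[OF \<mu> \<nu> conv isCont_gauss_deriv gauss_deriv_bound] a_pos) simp
  show "(\<integral>\<^sup>+x. ennreal (smear (gauss_fisher a) \<nu> x) \<partial>lborel) < \<infinity>"
    using real_distribution.nn_integral_smear_total[OF \<nu> _ gauss_fisher_bound gauss_fisher_nonneg] a_pos
    by (simp add: nn_integral_gauss_fisher)
  show "(\<lambda>n. \<integral>\<^sup>+x. ennreal \<bar>smear (gauss_fisher a) (\<mu> n) x - smear (gauss_fisher a) \<nu> x\<bar> \<partial>lborel) \<longlonglongrightarrow> 0"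
    by (rule smear_tendsto_L1[OF \<mu> \<nu> conv isCont_gauss_fisher gauss_fisher_bound gauss_fisher_nonneg])
      (use a_pos in \<open>simp_all add: nn_integral_gauss_fisher\<close>)
qed (intro fisher_integrand_le \<mu> \<nu>)+

end

section \<open>Compactness of the laws\<close>

text \<open>For a centred law this is the \<open>tail_variance\<close> of the smoothed variable.
  Without recentring it is an integral against the density alone, to which Fatou applies
  directly.\<close>

definition smoothed_tail :: "real \<Rightarrow> real measure \<Rightarrow> real \<Rightarrow> ennreal" where
  "smoothed_tail a \<mu> R =
     (\<integral>\<^sup>+x. ennreal (smear (gauss a) \<mu> x) * (ennreal (x\<^sup>2) * indicator {x. R \<le> \<bar>x\<bar>} x) \<partial>lborel)"

text \<open>An envelope for the laws behind \<open>smoothed_densities\<close>: means are left free,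
  and \<open>ennreal\<close> truncates negative values of \<open>l\<close> to 0. The true closure is
  cut out later as a closed subset.\<close>

definition tail_bounded_laws :: "real \<Rightarrow> (real \<Rightarrow> real) \<Rightarrow> real measure set" where
  "tail_bounded_laws a l = {\<mu>. real_distribution \<mu> \<and> (\<forall>R>0. smoothed_tail a \<mu> R \<le> ennreal (l R))}"

context
  fixes a :: real and l :: "real \<Rightarrow> real"
  assumes a_pos: "0 < a"
begin

text \<open>The square is at most \<open>R^2\<close> plus its part on
  \<open>\<bar>x\<bar> \<ge> R\<close>; the first term integrates to \<open>R^2\<close> because the
  density has mass one.\<close>

lemma smoothed_second_moment_le:
  assumes \<mu>: "\<mu> \<in> tail_bounded_laws a l" and R: "0 < R"
  shows "(\<integral>\<^sup>+x. ennreal (smear (gauss a) \<mu> x) * ennreal (x\<^sup>2) \<partial>lborel) \<le> ennreal (R\<^sup>2 + max 0 (l R))"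
proof -
  interpret real_distribution \<mu> using \<mu> by (simp add: tail_bounded_laws_def)
  have [measurable]: "smear (gauss a) \<mu> \<in> borel_measurable borel" by measurable
  let ?p = "\<lambda>x. ennreal (smear (gauss a) \<mu> x)"
  have "ennreal (x\<^sup>2) \<le> ennreal (R\<^sup>2) + ennreal (x\<^sup>2) * indicator {x. R \<le> \<bar>x\<bar>} x" for x
  proof (cases "R \<le> \<bar>x\<bar>")
    case False
    then have "\<bar>x\<bar>\<^sup>2 \<le> R\<^sup>2" by (intro power_mono) auto
    then show ?thesis using False by (simp add: ennreal_leI)
  qed simp
  then have "(\<integral>\<^sup>+x. ?p x * ennreal (x\<^sup>2) \<partial>lborel)
      \<le> (\<integral>\<^sup>+x. ?p x * (ennreal (R\<^sup>2) + ennreal (x\<^sup>2) * indicator {x. R \<le> \<bar>x\<bar>} x) \<partial>lborel)"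
    by (intro nn_integral_mono mult_left_mono) auto
  also have "\<dots> = (\<integral>\<^sup>+x. ?p x * ennreal (R\<^sup>2) \<partial>lborel) + smoothed_tail a \<mu> R"
    unfolding smoothed_tail_def distrib_left by (rule nn_integral_add) measurable
  also have "(\<integral>\<^sup>+x. ?p x * ennreal (R\<^sup>2) \<partial>lborel) = ennreal (R\<^sup>2)"
    using ac_density_smear_gauss[OF a_pos real_distribution_axioms]
    by (simp add: nn_integral_multc ac_density_def)
  also have "ennreal (R\<^sup>2) + smoothed_tail a \<mu> R \<le> ennreal (R\<^sup>2) + ennreal (l R)"
    using \<mu> R by (auto simp: tail_bounded_laws_def intro!: add_left_mono)
  also have "\<dots> = ennreal (R\<^sup>2 + max 0 (l R))"
    by (simp add: max_def ennreal_neg)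
  finally show ?thesis .
qed

lemma law_second_moment_le:
  assumes \<mu>: "\<mu> \<in> tail_bounded_laws a l" and R: "0 < R"
  shows "(\<integral>\<^sup>+y. ennreal (y\<^sup>2) \<partial>\<mu>) \<le> ennreal (R\<^sup>2 + max 0 (l R))"
proof -
  interpret real_distribution \<mu> using \<mu> by (simp add: tail_bounded_laws_def)
  have "(\<integral>\<^sup>+y. ennreal (y\<^sup>2) \<partial>\<mu>)
      \<le> (\<integral>\<^sup>+y. (\<integral>\<^sup>+x. ennreal (gauss a x) * ennreal ((x + y)\<^sup>2) \<partial>lborel) \<partial>\<mu>)"
    by (intro nn_integral_mono gauss_second_moment a_pos)
  also have "\<dots> = (\<integral>\<^sup>+x. ennreal (smear (gauss a) \<mu> x) * ennreal (x\<^sup>2) \<partial>lborel)"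
    by (rule nn_integral_smear[OF _ _ gauss_bound[OF a_pos], symmetric]) (auto simp: normal_density_nonneg)
  also note smoothed_second_moment_le[OF \<mu> R]
  finally show ?thesis .
qed

text \<open>A Chebyshev estimate from the uniform second moment bound.\<close>

lemma tail_bounded_laws_tight:
  assumes \<mu>: "\<And>n. \<mu> n \<in> tail_bounded_laws a l"
  shows "tight \<mu>"
  unfolding tight_def
proof (intro conjI allI impI)
  show rd: "real_distribution (\<mu> n)" for n using \<mu> by (simp add: tail_bounded_laws_def)
  fix \<epsilon> :: real assume "0 < \<epsilon>"
  \<comment> \<open>\<open>C\<close> is the second moment bound of
    \<open>law_second_moment_le\<close> at \<open>R = 1\<close>. The radius satisfies
    \<open>r > 1\<close>, so that \<open>y^2 \<ge> \<bar>y\<bar> \<ge> r\<close> outside the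
    interval, and \<open>C < \<epsilon> * r\<close>; hence the linear bound
    \<open>r * prob \<le> C\<close> is enough.\<close>
  define C where "C = 1 + max 0 (l 1)"
  define r where "r = 1 + C / \<epsilon>"
  have "0 < C" by (simp add: C_def)
  then have r: "1 < r" using \<open>0 < \<epsilon>\<close> by (simp add: r_def)
  have "C < \<epsilon> * r" using \<open>0 < \<epsilon>\<close> by (simp add: r_def distrib_left)
  have "1 - \<epsilon> < measure (\<mu> n) {- r<..r}" for n
  proof -
    interpret real_distribution "\<mu> n" by (rule rd)
    have "ennreal (r * prob (UNIV - {- r<..r})) = (\<integral>\<^sup>+y. ennreal r * indicator (UNIV - {- r<..r}) y \<partial>\<mu> n)"
      using r by (subst nn_integral_cmult) (auto simp: ennreal_mult emeasure_eq_measure)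
    also have "\<dots> \<le> (\<integral>\<^sup>+y. ennreal (y\<^sup>2) \<partial>\<mu> n)"
    proof (intro nn_integral_mono)
      fix y :: real
      have "r \<le> y\<^sup>2" if "y \<notin> {- r<..r}"
      proof -
        have "r \<le> \<bar>y\<bar>" using that r by auto
        then have "r * 1 \<le> \<bar>y\<bar> * \<bar>y\<bar>" using r by (intro mult_mono) auto
        then show ?thesis by (simp add: power2_eq_square)
      qed
      then show "ennreal r * indicator (UNIV - {- r<..r}) y \<le> ennreal (y\<^sup>2)"
        by (auto simp: indicator_def intro!: ennreal_leI)
    qed
    also have "\<dots> \<le> ennreal C"
      using law_second_moment_le[OF \<mu>, of 1 n] by (simp add: C_def)
    finally have "r * prob (UNIV - {- r<..r}) \<le> C"
      using \<open>0 < C\<close> by (subst (asm) ennreal_le_iff) auto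
    with \<open>C < \<epsilon> * r\<close> have "r * prob (UNIV - {- r<..r}) < r * \<epsilon>"
      by (simp add: mult.commute)
    then have "prob (UNIV - {- r<..r}) < \<epsilon>"
      using r by simp
    moreover have "prob (UNIV - {- r<..r}) = 1 - prob {- r<..r}"
      using prob_compl[of "{- r<..r}"] by simp
    ultimately show ?thesis by linarith
  qed
  then show "\<exists>u b. u < b \<and> (\<forall>n. 1 - \<epsilon> < measure (\<mu> n) {u<..b})"
    using r by (intro exI[of _ "- r"] exI[of _ r]) auto
qed

text \<open>Weak convergence makes the densities converge pointwise, and Fatou carries each tail
  bound to the limit.\<close>

lemma tail_bounded_laws_weak_conv_closed:
  assumes \<mu>: "\<And>n. \<mu> n \<in> tail_bounded_laws a l" and \<nu>: "real_distribution \<nu>" and conv: "weak_conv_m \<mu> \<nu>"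
  shows "\<nu> \<in> tail_bounded_laws a l"
proof -
  have rd: "real_distribution (\<mu> n)" for n using \<mu> by (simp add: tail_bounded_laws_def)
  note [measurable] = real_distribution.borel_measurable_smear[OF rd]
    real_distribution.borel_measurable_smear[OF \<nu>]
  have "smoothed_tail a \<nu> R \<le> ennreal (l R)" if "0 < R" for R
  proof -
    let ?F = "\<lambda>n x. ennreal (smear (gauss a) (\<mu> n) x) * (ennreal (x\<^sup>2) * indicator {x. R \<le> \<bar>x\<bar>} x)"
    have "liminf (\<lambda>n. ?F n x) = ennreal (smear (gauss a) \<nu> x) * (ennreal (x\<^sup>2) * indicator {x. R \<le> \<bar>x\<bar>} x)" for x
    proof (rule lim_imp_Liminf)
      have "(\<lambda>n. ennreal (x\<^sup>2) * indicator {x. R \<le> \<bar>x\<bar>} x * ennreal (smear (gauss a) (\<mu> n) x))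
          \<longlonglongrightarrow> ennreal (x\<^sup>2) * indicator {x. R \<le> \<bar>x\<bar>} x * ennreal (smear (gauss a) \<nu> x)"
        by (rule ennreal_tendsto_cmult)
          (auto simp: indicator_def intro!: tendsto_ennrealI smear_tendsto[OF rd \<nu> conv isCont_gauss gauss_bound] a_pos)
      then show "(\<lambda>n. ?F n x) \<longlonglongrightarrow> ennreal (smear (gauss a) \<nu> x) * (ennreal (x\<^sup>2) * indicator {x. R \<le> \<bar>x\<bar>} x)"
        by (simp add: mult.commute)
    qed simp
    then have "smoothed_tail a \<nu> R = (\<integral>\<^sup>+x. liminf (\<lambda>n. ?F n x) \<partial>lborel)"
      by (simp add: smoothed_tail_def)
    also have "\<dots> \<le> liminf (\<lambda>n. \<integral>\<^sup>+x. ?F n x \<partial>lborel)"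
      by (rule nn_integral_liminf) measurable
    also have "\<dots> \<le> limsup (\<lambda>n. smoothed_tail a (\<mu> n) R)"
      unfolding smoothed_tail_def by (rule Liminf_le_Limsup) simp
    also have "\<dots> \<le> ennreal (l R)"
      by (rule Limsup_bounded) (use \<mu> that in \<open>simp add: tail_bounded_laws_def\<close>)
    finally show ?thesis .
  qed
  with \<nu> show ?thesis by (simp add: tail_bounded_laws_def)
qed

lemma tail_bounded_laws_subseq:
  assumes \<mu>: "\<And>n. \<mu> n \<in> tail_bounded_laws a l"
  obtains r \<nu> where "strict_mono (r :: nat \<Rightarrow> nat)" "\<nu> \<in> tail_bounded_laws a l" "weak_conv_m (\<lambda>n. \<mu> (r n)) \<nu>"
proof -
  have "tight \<mu>" by (rule tail_bounded_laws_tight[OF \<mu>])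
  then obtain r \<nu> where "strict_mono r" "real_distribution \<nu>" "weak_conv_m (\<mu> \<circ> id \<circ> r) \<nu>"
    using tight_imp_convergent_subsubsequence[of \<mu> id] by (auto simp: strict_mono_def)
  then show ?thesis
    using that[of r \<nu>] tail_bounded_laws_weak_conv_closed[of "\<lambda>n. \<mu> (r n)" \<nu>] \<mu> by (simp add: o_def)
qed

end

section \<open>Convergence in the weighted space\<close>

text \<open>Transfers \<open>ennreal\<close> estimates to the real-valued distance. An infinite
  integral becomes 0 under both the Bochner integral and \<open>enn2real\<close>, so the two agree
  without integrability.\<close>

lemma L1_dist_tendsto_0:
  assumes [measurable]: "\<And>n. f n \<in> borel_measurable borel" "g \<in> borel_measurable borel"
      "w \<in> borel_measurable borel"
    and w: "\<And>x. 0 \<le> w x"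
    and lim: "(\<lambda>n. \<integral>\<^sup>+x. ennreal (\<bar>f n x - g x\<bar> * w x) \<partial>lborel) \<longlonglongrightarrow> 0"
  shows "(\<lambda>n. L1_dist w (abs_ae_fun (f n)) (abs_ae_fun g)) \<longlonglongrightarrow> 0"
proof -
  have "L1_dist w (abs_ae_fun (f n)) (abs_ae_fun g)
      = enn2real (\<integral>\<^sup>+x. ennreal (\<bar>f n x - g x\<bar> * w x) \<partial>lborel)" for n
    by (subst L1_dist_abs) (auto intro!: integral_eq_nn_integral simp: w)
  then show ?thesis
    using tendsto_enn2real[OF lim[folded ennreal_0]] by simp
qed

lemma borel_measurable_quad_weight [measurable]: "quad_weight \<in> borel_measurable borel"
  unfolding quad_weight_def[abs_def] by measurable

lemma borel_measurable_unit_weight [measurable]: "unit_weight \<in> borel_measurable borel"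
  unfolding unit_weight_def[abs_def] by measurable

lemma quad_weight_nonneg: "0 \<le> quad_weight x"
  by (simp add: quad_weight_def)

context
  fixes a :: real and l :: "real \<Rightarrow> real"
  assumes a_pos: "0 < a"
begin

lemma smear_gauss_in_L1_quad:
  assumes \<mu>: "\<mu> \<in> tail_bounded_laws a l"
  shows "abs_ae_fun (smear (gauss a) \<mu>) \<in> L1_space quad_weight"
proof -
  interpret real_distribution \<mu> using \<mu> by (simp add: tail_bounded_laws_def)
  let ?p = "smear (gauss a) \<mu>"
  have [measurable]: "?p \<in> borel_measurable borel" by measurable
  have pos: "0 \<le> ?p x" for x
    using smear_gauss_pos[OF a_pos real_distribution_axioms, of x] by simp
  have "ennreal (norm (\<bar>?p x\<bar> * quad_weight x)) = ennreal (?p x) + ennreal (?p x) * ennreal (x\<^sup>2)" for x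
    using pos[of x] by (simp add: quad_weight_def distrib_left ennreal_mult)
  then have "(\<integral>\<^sup>+x. ennreal (norm (\<bar>?p x\<bar> * quad_weight x)) \<partial>lborel)
      = (\<integral>\<^sup>+x. ennreal (?p x) \<partial>lborel) + (\<integral>\<^sup>+x. ennreal (?p x) * ennreal (x\<^sup>2) \<partial>lborel)"
    by (simp add: nn_integral_add)
  also have "\<dots> \<le> 1 + ennreal (1\<^sup>2 + max 0 (l 1))"
    using ac_density_smear_gauss[OF a_pos real_distribution_axioms] smoothed_second_moment_le[OF a_pos \<mu>, of 1]
    by (intro add_mono) (auto simp: ac_density_def)
  also have "\<dots> < \<infinity>" by simp
  finally have "integrable lborel (\<lambda>x. \<bar>?p x\<bar> * quad_weight x)"
    by (intro integrableI_bounded) auto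
  then show ?thesis by (simp add: in_L1_abs)
qed

lemma smear_gauss_in_L1:
  assumes "real_distribution \<mu>"
  shows "abs_ae_fun (smear (gauss a) \<mu>) \<in> L1_space unit_weight"
proof -
  interpret real_distribution \<mu> by fact
  have "integrable lborel (smear (gauss a) \<mu>)"
    using ac_density_smear_gauss[OF a_pos assms]
    by (intro integrableI_nonneg) (auto simp: ac_density_def)
  then show ?thesis by (simp add: in_L1_abs unit_weight_def)
qed

lemma smear_gauss_tendsto_L1:
  assumes "\<And>n. real_distribution (\<mu> n)" "real_distribution \<nu>" "weak_conv_m \<mu> \<nu>"
  shows "(\<lambda>n. \<integral>\<^sup>+x. ennreal \<bar>smear (gauss a) (\<mu> n) x - smear (gauss a) \<nu> x\<bar> \<partial>lborel) \<longlonglongrightarrow> 0"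
  by (rule smear_tendsto_L1[OF assms isCont_gauss gauss_bound])
    (use a_pos in \<open>simp_all add: nn_integral_gauss normal_density_nonneg\<close>)

text \<open>Inside \<open>\<bar>x\<bar> < R\<close> the weight is at most \<open>1 + R^2\<close>, so
  unweighted L1 convergence suffices; outside, both densities have tails controlled by
  \<open>l R\<close>.\<close>

lemma smear_gauss_tendsto_L1_quad:
  assumes l: "(l \<longlongrightarrow> 0) at_top" and \<mu>: "\<And>n. \<mu> n \<in> tail_bounded_laws a l"
    and \<nu>: "\<nu> \<in> tail_bounded_laws a l" and conv: "weak_conv_m \<mu> \<nu>"
  shows "(\<lambda>n. \<integral>\<^sup>+x. ennreal (\<bar>smear (gauss a) (\<mu> n) x - smear (gauss a) \<nu> x\<bar> * quad_weight x) \<partial>lborel) \<longlonglongrightarrow> 0"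
    (is "?X \<longlonglongrightarrow> 0")
proof -
  have rd: "real_distribution (\<mu> n)" "real_distribution \<nu>" for n
    using \<mu> \<nu> by (simp_all add: tail_bounded_laws_def)
  note [measurable] = real_distribution.borel_measurable_smear[OF rd(1)]
    real_distribution.borel_measurable_smear[OF rd(2)]
  let ?p = "\<lambda>n. smear (gauss a) (\<mu> n)" and ?q = "smear (gauss a) \<nu>"
  let ?D = "\<lambda>n. \<integral>\<^sup>+x. ennreal \<bar>?p n x - ?q x\<bar> \<partial>lborel"
  \<comment> \<open>The factor 4: outside, the weight is at most \<open>2 * x^2\<close> because
    \<open>R \<ge> 1\<close>, and the difference is at most the sum of two densities, each with tail
    at most \<open>l R\<close>.\<close>
  have bound: "limsup ?X \<le> 4 * ennreal (l R)" if R: "1 \<le> R" for R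
  proof -
    let ?t = "\<lambda>x. ennreal (x\<^sup>2) * indicator {x. R \<le> \<bar>x\<bar>} x"
    have pointwise: "ennreal (\<bar>?p n x - ?q x\<bar> * quad_weight x)
        \<le> ennreal (1 + R\<^sup>2) * ennreal \<bar>?p n x - ?q x\<bar> + 2 * (ennreal (?p n x) * ?t x + ennreal (?q x) * ?t x)"
      for n x
    proof (cases "R \<le> \<bar>x\<bar>")
      case True
      have "1\<^sup>2 \<le> \<bar>x\<bar>\<^sup>2" using True R by (intro power_mono) auto
      then have "quad_weight x \<le> 2 * x\<^sup>2" by (simp add: quad_weight_def)
      moreover have nn: "0 \<le> ?p n x" "0 \<le> ?q x"
        using smear_gauss_pos[OF a_pos rd(1), of n x] smear_gauss_pos[OF a_pos rd(2), of x] by auto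
      ultimately have "\<bar>?p n x - ?q x\<bar> * quad_weight x \<le> (?p n x + ?q x) * (2 * x\<^sup>2)"
        by (intro mult_mono) (auto simp: quad_weight_nonneg)
      then have "ennreal (\<bar>?p n x - ?q x\<bar> * quad_weight x) \<le> ennreal ((?p n x + ?q x) * (2 * x\<^sup>2))"
        by (rule ennreal_leI)
      also have "\<dots> = 2 * (ennreal (?p n x) * ?t x + ennreal (?q x) * ?t x)"
        using nn True by (simp add: ennreal_mult ennreal_plus algebra_simps flip: ennreal_numeral)
      also have "\<dots> \<le> ennreal (1 + R\<^sup>2) * ennreal \<bar>?p n x - ?q x\<bar> + \<dots>" by simp
      finally show ?thesis .
    next
      case False
      then have "\<bar>x\<bar>\<^sup>2 \<le> R\<^sup>2" by (intro power_mono) auto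
      then have "\<bar>?p n x - ?q x\<bar> * quad_weight x \<le> \<bar>?p n x - ?q x\<bar> * (1 + R\<^sup>2)"
        by (intro mult_left_mono) (auto simp: quad_weight_def)
      then have "ennreal (\<bar>?p n x - ?q x\<bar> * quad_weight x) \<le> ennreal (1 + R\<^sup>2) * ennreal \<bar>?p n x - ?q x\<bar>"
        by (subst ennreal_mult[symmetric]) (auto intro!: ennreal_leI simp: mult.commute)
      also have "\<dots> \<le> \<dots> + 2 * (ennreal (?p n x) * ?t x + ennreal (?q x) * ?t x)" by simp
      finally show ?thesis .
    qed
    have "?X n \<le> ennreal (1 + R\<^sup>2) * ?D n + 4 * ennreal (l R)" for n
    proof -
      have "?X n \<le> (\<integral>\<^sup>+x. ennreal (1 + R\<^sup>2) * ennreal \<bar>?p n x - ?q x\<bar>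
          + 2 * (ennreal (?p n x) * ?t x + ennreal (?q x) * ?t x) \<partial>lborel)"
        by (intro nn_integral_mono pointwise)
      also have "\<dots> = ennreal (1 + R\<^sup>2) * ?D n + 2 * (smoothed_tail a (\<mu> n) R + smoothed_tail a \<nu> R)"
        unfolding smoothed_tail_def by (simp add: nn_integral_add nn_integral_cmult)
      also have "\<dots> \<le> ennreal (1 + R\<^sup>2) * ?D n + 2 * (ennreal (l R) + ennreal (l R))"
        using \<mu> \<nu> R by (intro add_mono mult_left_mono) (auto simp: tail_bounded_laws_def)
      also have "2 * (ennreal (l R) + ennreal (l R)) = 4 * ennreal (l R)"
        by (simp flip: mult_2 mult.assoc)
      finally show ?thesis .
    qed
    then have "limsup ?X \<le> limsup (\<lambda>n. ennreal (1 + R\<^sup>2) * ?D n + 4 * ennreal (l R))"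
      by (intro Limsup_mono always_eventually allI)
    also have "\<dots> = ennreal (1 + R\<^sup>2) * 0 + 4 * ennreal (l R)"
      by (intro lim_imp_Limsup tendsto_add tendsto_const ennreal_tendsto_cmult smear_gauss_tendsto_L1 rd conv) auto
    finally show ?thesis by simp
  qed
  have "((\<lambda>R. 4 * ennreal (l R)) \<longlongrightarrow> 4 * ennreal 0) at_top"
    by (intro ennreal_tendsto_cmult tendsto_ennrealI l) simp
  \<comment> \<open>The left-hand side does not depend on \<open>R\<close>, so \<open>R\<close> may
    tend to infinity.\<close>
  then have "limsup ?X \<le> 4 * ennreal 0"
    by (rule tendsto_lowerbound) (auto intro!: eventually_mono[OF eventually_ge_at_top[of 1]] bound)
  then show ?thesis
    by (intro tendsto_0_if_Limsup_eq_0_ennreal) simp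
qed

end

section \<open>Densities of smoothed random variables\<close>

text \<open>The law of an independent sum is the convolution of the laws; on each Borel set it is
  evaluated by \<open>nn_integral_smear\<close> with an indicator.\<close>

lemma smoothed_pair_density:
  fixes M :: "'w measure"
  assumes a_pos: "0 < a" and pair: "smoothed_pair a l M X0 G"
  shows "distributed M lborel (\<lambda>\<omega>. X0 \<omega> + G \<omega>) (\<lambda>x. ennreal (smear (gauss a) (distr M borel X0) x))"
proof -
  interpret prob_space M using pair by (simp add: smoothed_pair_def)
  have G: "distributed M lborel G (\<lambda>x. ennreal (gauss a x))"
    using pair by (simp add: smoothed_pair_def)
  have [measurable]: "X0 \<in> borel_measurable M" "G \<in> borel_measurable M"
    using pair G by (auto simp: smoothed_pair_def distributed_def)
  define \<mu> where "\<mu> = distr M borel X0"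
  interpret \<mu>: real_distribution \<mu> unfolding \<mu>_def by simp
  interpret \<nu>: real_distribution "distr M borel G" by simp
  have "distr M lborel (\<lambda>\<omega>. X0 \<omega> + G \<omega>) = density lborel (\<lambda>x. ennreal (smear (gauss a) \<mu> x))"
  proof (rule measure_eqI)
    fix A assume "A \<in> sets (distr M lborel (\<lambda>\<omega>. X0 \<omega> + G \<omega>))"
    then have A[measurable]: "A \<in> sets borel" by simp
    have "distr M borel (\<lambda>\<omega>. X0 \<omega> + G \<omega>) = (\<mu> \<star> distr M borel G)"
      unfolding \<mu>_def by (rule sum_indep_random_variable) (use pair in \<open>auto simp: smoothed_pair_def\<close>)
    \<comment> \<open>As a target of \<open>distr\<close>, \<open>lborel\<close> matters only
      through its sigma-algebra, that of \<open>borel\<close>.\<close>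
    then have "emeasure (distr M lborel (\<lambda>\<omega>. X0 \<omega> + G \<omega>)) A = emeasure (\<mu> \<star> distr M borel G) A"
      by (metis A distr_cong sets_lborel)
    also have "\<dots> = (\<integral>\<^sup>+y. \<integral>\<^sup>+x. indicator A (y + x) \<partial>distr M borel G \<partial>\<mu>)"
      by (rule convolution_emeasure') (auto intro: \<mu>.finite_measure_axioms \<nu>.finite_measure_axioms)
    also have "\<dots> = (\<integral>\<^sup>+y. (\<integral>\<^sup>+x. ennreal (gauss a x) * indicator A (x + y) \<partial>lborel) \<partial>\<mu>)"
    proof (rule nn_integral_cong)
      fix y
      have "(\<integral>\<^sup>+x. indicator A (y + x) \<partial>distr M borel G) = (\<integral>\<^sup>+\<omega>. indicator A (G \<omega> + y) \<partial>M)"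
        by (simp add: nn_integral_distr add.commute)
      also have "\<dots> = (\<integral>\<^sup>+x. ennreal (gauss a x) * indicator A (x + y) \<partial>lborel)"
        by (rule distributed_nn_integral[OF G, symmetric]) measurable
      finally show "(\<integral>\<^sup>+x. indicator A (y + x) \<partial>distr M borel G)
          = (\<integral>\<^sup>+x. ennreal (gauss a x) * indicator A (x + y) \<partial>lborel)" .
    qed
    also have "\<dots> = (\<integral>\<^sup>+x. ennreal (smear (gauss a) \<mu> x) * indicator A x \<partial>lborel)"
      by (rule \<mu>.nn_integral_smear[OF _ _ gauss_bound[OF a_pos], symmetric]) (auto simp: normal_density_nonneg)
    also have "\<dots> = emeasure (density lborel (\<lambda>x. ennreal (smear (gauss a) \<mu> x))) A"
      by (subst emeasure_density) auto
    finally show "emeasure (distr M lborel (\<lambda>\<omega>. X0 \<omega> + G \<omega>)) A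
        = emeasure (density lborel (\<lambda>x. ennreal (smear (gauss a) \<mu> x))) A" .
  qed simp
  then show ?thesis
    unfolding distributed_def \<mu>_def[symmetric] by simp
qed

text \<open>Uniqueness of densities identifies the class with a Gaussian mixture, and the tail
  condition passes to the law of \<open>X0\<close> because the sum is centred.\<close>

lemma smoothed_densities_subset:
  assumes a_pos: "0 < a"
  shows "smoothed_densities a l \<subseteq> (\<lambda>\<mu>. abs_ae_fun (smear (gauss a) \<mu>)) ` tail_bounded_laws a l"
proof
  fix p assume "p \<in> smoothed_densities a l"
  then obtain M :: "(real \<times> real) measure" and X0 G f where pair: "smoothed_pair a l M X0 G"
    and f: "\<And>x. 0 \<le> f x" "distributed M lborel (\<lambda>\<omega>. X0 \<omega> + G \<omega>) (\<lambda>x. ennreal (f x))" "represents f p"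
    unfolding smoothed_densities_def by blast
  interpret prob_space M using pair by (simp add: smoothed_pair_def)
  define \<mu> where "\<mu> = distr M borel X0"
  let ?S = "\<lambda>\<omega>. X0 \<omega> + G \<omega>" and ?q = "smear (gauss a) \<mu>"
  have G: "distributed M lborel G (\<lambda>x. ennreal (gauss a x))"
    using pair by (simp add: smoothed_pair_def)
  have X0[measurable]: "X0 \<in> borel_measurable M" using pair by (simp add: smoothed_pair_def)
  interpret \<mu>: real_distribution \<mu> unfolding \<mu>_def by simp
  have dens: "distributed M lborel ?S (\<lambda>x. ennreal (?q x))"
    unfolding \<mu>_def by (rule smoothed_pair_density[OF a_pos pair])
  have q: "?q \<in> borel_measurable borel" "0 \<le> ?q x" for x
    using smear_gauss_pos[OF a_pos \<mu>.real_distribution_axioms, of x] by auto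

  have "AE x in lborel. ennreal (f x) = ennreal (?q x)"
    by (rule distributed_unique[OF f(2) dens])
  then have "AE x in lborel. f x = ?q x"
    by eventually_elim (simp add: f(1) q(2))
  moreover obtain h where h: "h \<in> borel_measurable borel" "p = abs_ae_fun h" by (rule ae_fun_exhaust)
  moreover have "f \<in> borel_measurable borel" "AE x in lborel. f x = h x"
    using f(3) h by (auto simp: represents_abs ae_eq_def)
  ultimately have p: "p = abs_ae_fun ?q"
    using q(1) by (metis abs_ae_fun_eq)

  have "integrable M G"
    using distributed_integrable[OF G, of "\<lambda>x. x"] integrable_normal_moment_nz_1[of "sqrt a" 0] a_pos
    by (simp add: normal_density_nonneg)
  moreover have "expectation G = 0"
    by (rule normal_distributed_expectation[OF _ G]) (use a_pos in simp)
  ultimately have mean: "expectation ?S = 0"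
    using pair by (simp add: smoothed_pair_def)
  have "smoothed_tail a \<mu> R \<le> ennreal (l R)" if "0 < R" for R
  proof -
    have "smoothed_tail a \<mu> R = (\<integral>\<^sup>+\<omega>. ennreal ((?S \<omega>)\<^sup>2) * indicator {x. R \<le> \<bar>x\<bar>} (?S \<omega>) \<partial>M)"
      unfolding smoothed_tail_def by (rule distributed_nn_integral[OF dens]) measurable
    also have "\<dots> = tail_variance M ?S R"
      unfolding tail_variance_def mean by (simp add: indicator_def)
    finally have "enn2ereal (smoothed_tail a \<mu> R) \<le> ereal (l R)"
      using pair that by (simp add: smoothed_pair_def)
    then show ?thesis
      \<comment> \<open>Applying the monotone map \<open>e2ennreal\<close> to both sides turns the
        extended-real bound into one in \<open>ennreal\<close>.\<close>
      by (metis e2ennreal_ereal e2ennreal_mono e2ennreal_enn2ereal)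
  qed
  then have "\<mu> \<in> tail_bounded_laws a l"
    using \<mu>.real_distribution_axioms by (simp add: tail_bounded_laws_def)
  with p show "p \<in> (\<lambda>\<mu>. abs_ae_fun (smear (gauss a) \<mu>)) ` tail_bounded_laws a l" by blast
qed

section \<open>Compactness and continuity\<close>

text \<open>Otherwise infinitely many terms avoid some neighbourhood of \<open>L\<close>;
  enumerating them gives a subsequence none of whose subsequences converges to
  \<open>L\<close>.\<close>

lemma tendsto_if_subseq_tendsto:
  fixes X :: "nat \<Rightarrow> 'a :: topological_space"
  assumes "\<And>r. strict_mono r \<Longrightarrow> \<exists>s. strict_mono (s :: nat \<Rightarrow> nat) \<and> (\<lambda>n. X (r (s n))) \<longlonglongrightarrow> L"
  shows "X \<longlonglongrightarrow> L"
proof (rule topological_tendstoI, rule ccontr)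
  fix S assume S: "open S" "L \<in> S" and "\<not> (\<forall>\<^sub>F n in sequentially. X n \<in> S)"
  then have inf: "infinite {n. X n \<notin> S}"
    by (simp add: frequently_cofinite[symmetric] cofinite_eq_sequentially not_eventually)
  define r where "r = enumerate {n. X n \<notin> S}"
  have "strict_mono r" and r: "X (r n) \<notin> S" for n
    using inf enumerate_in_set[OF inf] by (auto simp: r_def strict_mono_enumerate)
  then obtain s where "(\<lambda>n. X (r (s n))) \<longlonglongrightarrow> L" using assms by blast
  then have "\<forall>\<^sub>F n in sequentially. X (r (s n)) \<in> S" using S by (rule topological_tendstoD)
  with r show False by simp
qed

theorem theorem3p1:
  fixes a :: real and l :: "real \<Rightarrow> real"
  assumes "0 < a" and "(l \<longlongrightarrow> 0) at_top"
  shows "compactin L1_quad.mtopology (smoothed_closure a l) \<and>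
    compactin L1.mtopology (smoothed_closure a l) \<and>
    (\<forall>p\<in>smoothed_closure a l. fisher_information p < \<infinity>) \<and>
    continuous_map (subtopology L1.mtopology (smoothed_closure a l)) euclidean fisher_information \<and>
    (\<forall>P p. range P \<subseteq> smoothed_closure a l \<longrightarrow> p \<in> smoothed_closure a l \<longrightarrow>
       (\<lambda>n. L1_dist unit_weight (P n) p) \<longlonglongrightarrow> 0 \<longrightarrow>
       (\<lambda>n. fisher_information (P n)) \<longlonglongrightarrow> fisher_information p)"
proof -
  define cls where "cls \<mu> = abs_ae_fun (smear (gauss a) \<mu>)" for \<mu>
  define K where "K = cls ` tail_bounded_laws a l"
  let ?C = "smoothed_closure a l"
  \<comment> \<open>The core of the argument: one weakly convergent subsequence of laws provides the
    weighted limit, the unweighted limit and the limit of the Fisher information, all with the same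
    \<open>q\<close>.\<close>
  have subseq: "\<exists>r q. strict_mono r \<and> q \<in> K \<and> limitin L1_quad.mtopology (P \<circ> r) q sequentially \<and>
      limitin L1.mtopology (P \<circ> r) q sequentially \<and>
      (\<lambda>n. fisher_information (P (r n))) \<longlonglongrightarrow> fisher_information q"
    if P: "range P \<subseteq> K" for P :: "nat \<Rightarrow> ae_fun"
  proof -
    have "\<forall>n. \<exists>\<mu>. \<mu> \<in> tail_bounded_laws a l \<and> P n = cls \<mu>" using P by (auto simp: K_def)
    then obtain \<mu> where \<mu>: "\<And>n. \<mu> n \<in> tail_bounded_laws a l" "\<And>n. P n = cls (\<mu> n)" by metis
    obtain r \<nu> where r: "strict_mono r" and \<nu>: "\<nu> \<in> tail_bounded_laws a l"
      and conv: "weak_conv_m (\<lambda>n. \<mu> (r n)) \<nu>"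
      by (rule tail_bounded_laws_subseq[OF assms(1) \<mu>(1)])
    have rd: "real_distribution (\<mu> n)" "real_distribution \<nu>" for n
      using \<mu>(1) \<nu> by (simp_all add: tail_bounded_laws_def)
    note [measurable] = real_distribution.borel_measurable_smear[OF rd(1)]
      real_distribution.borel_measurable_smear[OF rd(2)]
    have "(\<lambda>n. L1_dist quad_weight (cls (\<mu> (r n))) (cls \<nu>)) \<longlonglongrightarrow> 0"
      unfolding cls_def
      by (rule L1_dist_tendsto_0[OF _ _ _ quad_weight_nonneg
            smear_gauss_tendsto_L1_quad[OF assms \<mu>(1) \<nu> conv]]) measurable
    then have "limitin L1_quad.mtopology (P \<circ> r) (cls \<nu>) sequentially"
      using smear_gauss_in_L1_quad[where l = l, OF assms(1)] \<mu> \<nu>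
      by (simp add: L1_quad.limitin_metric_dist_null o_def cls_def)
    moreover have "(\<lambda>n. L1_dist unit_weight (cls (\<mu> (r n))) (cls \<nu>)) \<longlonglongrightarrow> 0"
      unfolding cls_def
      by (rule L1_dist_tendsto_0)
        (use smear_gauss_tendsto_L1[OF assms(1) rd conv] in \<open>simp_all add: unit_weight_def\<close>)
    then have "limitin L1.mtopology (P \<circ> r) (cls \<nu>) sequentially"
      using smear_gauss_in_L1[OF assms(1)] \<mu> rd
      by (simp add: L1.limitin_metric_dist_null o_def cls_def)
    moreover have "(\<lambda>n. fisher_information (P (r n))) \<longlonglongrightarrow> fisher_information (cls \<nu>)"
      using fisher_information_weak_conv[OF assms(1) rd conv] by (simp add: \<mu>(2) cls_def)
    ultimately show ?thesis using r \<nu> by (auto simp: K_def)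
  qed
  have "K \<subseteq> L1_space quad_weight"
    using smear_gauss_in_L1_quad[OF assms(1)] by (auto simp: K_def cls_def)
  then have K_compact: "compactin L1_quad.mtopology K"
    unfolding L1_quad.compactin_sequentially using subseq by blast
  then have "closedin L1_quad.mtopology K"
    by (rule compactin_imp_closedin[OF L1_quad.Hausdorff_space_mtopology])
  \<comment> \<open>Being closed, \<open>K\<close> contains the closure of
    \<open>smoothed_densities\<close>; every limit class is thus again a Gaussian mixture.\<close>
  then have C_K: "?C \<subseteq> K"
    unfolding smoothed_closure_def using smoothed_densities_subset[OF assms(1)]
    by (intro closure_of_minimal) (auto simp: K_def cls_def)
  have C_closed: "closedin L1_quad.mtopology ?C"
    unfolding smoothed_closure_def by (rule closedin_closure_of)
  have compact: "compactin L1_quad.mtopology ?C"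
    by (rule closed_compactin[OF K_compact C_K C_closed])
  have K_L1: "K \<subseteq> L1_space unit_weight"
    using smear_gauss_in_L1[OF assms(1)] by (auto simp: K_def cls_def tail_bounded_laws_def)
  \<comment> \<open>The extracted limit is common to both metrics: closedness in the weighted space
    puts it into \<open>?C\<close>, and the convergence used is the unweighted one.\<close>
  have compact_L1: "compactin L1.mtopology ?C"
    unfolding L1.compactin_sequentially
  proof (intro conjI allI impI)
    fix P :: "nat \<Rightarrow> ae_fun" assume P: "range P \<subseteq> ?C"
    then obtain r q where r: "strict_mono r" and q: "limitin L1_quad.mtopology (P \<circ> r) q sequentially"
        "limitin L1.mtopology (P \<circ> r) q sequentially"
      using subseq[of P] C_K by blast
    have "range (P \<circ> r) \<subseteq> ?C" using P by auto
    then have "q \<in> ?C"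
      using C_closed q(1) unfolding L1_quad.metric_closedin_iff_sequentially_closed by blast
    then show "\<exists>q r. q \<in> ?C \<and> strict_mono r \<and> limitin L1.mtopology (P \<circ> r) q sequentially"
      using r q by blast
  qed (use C_K K_L1 in blast)
  have C_closed_L1: "closedin L1.mtopology ?C"
    by (rule compactin_imp_closedin[OF L1.Hausdorff_space_mtopology compact_L1])
  \<comment> \<open>Every subsequence has a further one along which the Fisher information converges
    to that of some L1 limit \<open>q\<close>, and uniqueness of L1 limits forces
    \<open>q = p\<close>.\<close>
  have seq: "(\<lambda>n. fisher_information (P n)) \<longlonglongrightarrow> fisher_information p"
    if P: "range P \<subseteq> ?C" and lim: "limitin L1.mtopology P p sequentially" for P p
  proof (rule tendsto_if_subseq_tendsto)
    fix r :: "nat \<Rightarrow> nat" assume "strict_mono r"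
    have "range (P \<circ> r) \<subseteq> K" using P C_K by auto
    then obtain s q where s: "strict_mono s" "limitin L1.mtopology (P \<circ> r \<circ> s) q sequentially"
        "(\<lambda>n. fisher_information (P (r (s n)))) \<longlonglongrightarrow> fisher_information q"
      using subseq[of "P \<circ> r"] by auto
    have "limitin L1.mtopology (P \<circ> (r \<circ> s)) p sequentially"
      by (rule limitin_subsequence[OF strict_mono_o[OF \<open>strict_mono r\<close> s(1)] lim])
    with s(2) have "q = p"
      by (metis L1.limitin_metric_unique comp_assoc trivial_limit_sequentially)
    with s show "\<exists>s. strict_mono s \<and> (\<lambda>n. fisher_information (P (r (s n)))) \<longlonglongrightarrow> fisher_information p"
      by blast
  qed
  have "continuous_map (subtopology L1.mtopology ?C) euclidean fisher_information"
    unfolding continuous_map_closedin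
  proof (intro conjI allI impI)
    fix S :: "ennreal set" assume "closedin euclidean S"
    then have S: "closed S" by simp
    \<comment> \<open>In a metric space closedness can be tested on sequences, which reduces
      continuity to \<open>seq\<close>.\<close>
    have "closedin L1.mtopology {p \<in> ?C. fisher_information p \<in> S}"
      unfolding L1.metric_closedin_iff_sequentially_closed
    proof (intro conjI allI impI)
      fix P p assume P: "range P \<subseteq> {p \<in> ?C. fisher_information p \<in> S} \<and> limitin L1.mtopology P p sequentially"
      then have "range P \<subseteq> ?C" by auto
      moreover from this have "p \<in> ?C"
        using C_closed_L1 P unfolding L1.metric_closedin_iff_sequentially_closed by blast
      moreover have "fisher_information p \<in> S"
      proof (rule closed_sequentially[OF S])
        show "fisher_information (P n) \<in> S" for n using P by auto
        show "(\<lambda>n. fisher_information (P n)) \<longlonglongrightarrow> fisher_information p"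
          using seq[OF \<open>range P \<subseteq> ?C\<close>] P by simp
      qed
      ultimately show "p \<in> {p \<in> ?C. fisher_information p \<in> S}" by simp
    qed (use C_K K_L1 in auto)
    moreover have "topspace (subtopology L1.mtopology ?C) = ?C"
      using C_K K_L1 by auto
    ultimately show "closedin (subtopology L1.mtopology ?C)
        {p \<in> topspace (subtopology L1.mtopology ?C). fisher_information p \<in> S}"
      using C_closed_L1 by (simp add: closedin_closed_subtopology)
  qed simp
  moreover have "\<forall>p\<in>?C. fisher_information p < \<infinity>"
    using C_K fisher_information_smear_gauss_finite[OF assms(1)]
    by (auto simp: K_def cls_def tail_bounded_laws_def)
  moreover have "limitin L1.mtopology P p sequentially"
    if "range P \<subseteq> ?C" "p \<in> ?C" "(\<lambda>n. L1_dist unit_weight (P n) p) \<longlonglongrightarrow> 0" for P p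
    using that C_K K_L1 unfolding L1.limitin_metric_dist_null by (auto simp: subset_iff)
  ultimately show ?thesis
    using compact compact_L1 seq by blast
qed

end
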